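(* Let $n \geq 1$, let $\mathbb{K}$ be an $n$-dimensional local field, and let $\mathcal{T}_{\mathbb{K}} = \mathbb{G}_{m,\mathbb{K}}^{m}$ be an $m$-dimensional algebraic torus over $\mathbb{K}$ with character lattice $M$. Let $\mathcal{X}_{f}$ be a reduced, irreducible hypersurface in $\mathcal{T}_{\mathbb{K}}$, defined by a Laurent polynomial $f$ over $\mathbb{K}$. Then the tropicalization $Trop(\mathcal{X}_{f}) \subset \mathrm{Hom}(M,\Gamma_{\mathbb{R}}) \cong \mathbb{R}^{nm}$ is a rational polyhedral complex of dimension $mn - n$.
   Context: Higher local fields. An $n$-dimensional local field over a field $\mathbf{k}$ is a sequence of fields $(\mathbb{K}_{(0)}, \ldots, \mathbb{K}_{(n)})$ with $\mathbb{K}_{(0)} = \mathbf{k}$, $\mathbb{K} = \mathbb{K}_{(n)}$, such that for $1 \le i \le n$ the field $\mathbb{K}_{(i)}$ is complete with respect to a nontrivial discrete rank one valuation $w_{(i)} : \mathbb{K}_{(i)}^{\times} \to \mathbb{Z}$ whose residue field is $\mathbb{K}_{(i-1)}$. For $f \in \mathbb{K}$ with $w_{(n)}(f) = \cdots = w_{(j+1)}(f) = 0$, the symbol $w_{(j)}(f)$ denotes $w_{(j)}$ of the image of $f$ in $\mathbb{K}_{(j)}$ under successive reduction to residue fields (value $\infty$ at $0$). The rank $n$ valuation. Let $\mathcal{O}_{\nu}^{\mathbb{K}} \subset \mathbb{K}$ be the set of $f$ such that either $w_{(n)}(f) \ge 1$, or for some $1 \le i \le n-1$ one has $w_{(n)}(f)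 = \cdots = w_{(n-i+1)}(f) = 0$ and $w_{(n-i)}(f) \ge 1$, or $w_{(n)}(f) = \cdots = w_{(1)}(f) = 0$. This is a valuation ring of $\mathbb{K}$, and $\Gamma^{\mathbb{K}} := \mathbb{K}^{\times}/(\mathcal{O}_{\nu}^{\mathbb{K}})^{\times} \cong \mathbb{Z}^{n}$ as ordered groups, where $\mathbb{Z}^n$ has the lexicographic order in which the last coordinate is the most significant; the last coordinate of the quotient map $\nu : \mathbb{K}^\times \to \Gamma^{\mathbb{K}}$ is $w_{(n)}$. A finite extension $\mathbb{L}$ of $\mathbb{K}$ is canonically an $n$-dimensional local field with each $\mathbb{L}_{(i)}$ finite over $\mathbb{K}_{(i)}$, and $\nu$ extends compatibly to $\mathbb{L}^{\times} \to \Gamma^{\mathbb{L}}$. Let $\mathbb{K}^{al}$ be an algebraic closure, $\Gamma_{\mathbb{Q}} := \varinjlim \Gamma^{\mathbb{L}}$ over finite extensions $\mathbb{L}/\mathbb{K}$ (a $\mathbb{Q}$-vector space containing $\Gamma^{\mathbb{K}}$ as a $\mathbb{Z}$-lattice), and $\Gamma_{\mathbb{R}} := \Gamma_{\mathbb{Q}} \otimes_{\mathbb{Q}} \mathbb{R} \cong \mathbb{R}^{n}$ with the lexicographic order. This gives $\nu : (\mathbb{K}^{al})^{\times} \to \Gamma_{\mathbb{Q}} \subset \Gamma_{\mathbb{R}}$. Tropicalization. $Trop : \mathcal{T}_{\mathbb{K}}(\mathbb{K}^{al}) \to \mathrm{Hom}(M, \Gamma_{\mathbb{R}})$ sends $\mathbf{t}$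 to the homomorphism $\chi \mapsto \nu(\chi(\mathbf{t}))$; under the identification $\mathrm{Hom}(M,\Gamma_{\mathbb{R}}) \cong \Gamma_{\mathbb{R}}^{m}$ given by the standard basis of $M$ it is the coordinatewise valuation. For a closed reduced subscheme $\mathcal{X} \subset \mathcal{T}_{\mathbb{K}}$, $Trop(\mathcal{X})$ is the topological closure in the real vector space $\mathrm{Hom}(M, \Gamma_{\mathbb{R}})$ of the image of $\mathcal{X}(\mathbb{K}^{al})$ under this map. Rationality of polyhedra is with respect to the rational structure given by $\Gamma_{\mathbb{Q}} \subset \Gamma_{\mathbb{R}}$. *)

theory Defs
  imports
    "HOL-Analysis.Analysis"
    "HOL-Algebra.Algebraic_Closure_Type"
    "HOL-Algebra.Embedded_Algebras"
    "HOL-Library.Poly_Mapping"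
begin

unbundle no fps_syntax

section \<open>Higher local fields\<close>

text \<open>
  A valuation is a function \<open>w\<close> into the integers whose value at zero is irrelevant; the convention
  that zero has infinite valuation is built into the predicates \<open>val_ge\<close> and \<open>val_unit\<close>.
\<close>

definition val_ge :: "('a, 'b) ring_scheme \<Rightarrow> ('a \<Rightarrow> int) \<Rightarrow> int \<Rightarrow> 'a \<Rightarrow> bool" where
  "val_ge R w N x \<longleftrightarrow> x = \<zero>\<^bsub>R\<^esub> \<or> N \<le> w x"

definition val_unit :: "('a, 'b) ring_scheme \<Rightarrow> ('a \<Rightarrow> int) \<Rightarrow> 'a \<Rightarrow> bool" where
  "val_unit R w x \<longleftrightarrow> x \<noteq> \<zero>\<^bsub>R\<^esub> \<and> w x = 0"

definition discrete_valuation :: "('a, 'b) ring_scheme \<Rightarrow> ('a \<Rightarrow> int) \<Rightarrow> bool" where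
  "discrete_valuation R w \<longleftrightarrow>
     (\<forall>x \<in> carrier R - {\<zero>\<^bsub>R\<^esub>}. \<forall>y \<in> carrier R - {\<zero>\<^bsub>R\<^esub>}.
        w (x \<otimes>\<^bsub>R\<^esub> y) = w x + w y \<and> val_ge R w (min (w x) (w y)) (x \<oplus>\<^bsub>R\<^esub> y)) \<and>
     (\<exists>x \<in> carrier R - {\<zero>\<^bsub>R\<^esub>}. w x \<noteq> 0)"

definition valuation_complete :: "('a, 'b) ring_scheme \<Rightarrow> ('a \<Rightarrow> int) \<Rightarrow> bool" where
  "valuation_complete R w \<longleftrightarrow>
     (\<forall>s :: nat \<Rightarrow> 'a.
        (\<forall>i. s i \<in> carrier R) \<and>
        (\<forall>N. \<exists>k. \<forall>i\<ge>k. \<forall>j\<ge>k. val_ge R w N (s i \<ominus>\<^bsub>R\<^esub> s j)) \<longrightarrow>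
        (\<exists>l \<in> carrier R. \<forall>N. \<exists>k. \<forall>i\<ge>k. val_ge R w N (s i \<ominus>\<^bsub>R\<^esub> l)))"

definition valuation_ring :: "('a, 'b) ring_scheme \<Rightarrow> ('a \<Rightarrow> int) \<Rightarrow> ('a, 'b) ring_scheme" where
  "valuation_ring R w = R\<lparr>carrier := {x \<in> carrier R. val_ge R w 0 x}\<rparr>"

text \<open>
  In a tower, \<open>valn T i\<close> is a valuation on the field \<open>level T i\<close>, and \<open>resmap T i\<close> is the reduction
  map from its valuation ring onto \<open>level T (i - 1)\<close>; it identifies the latter with the residue
  field.  All fields of a tower have carriers in one type, which is no restriction: each residue
  field has at most the cardinality of the top field.
\<close>

record 'a local_tower =
  level :: "nat \<Rightarrow> 'a ring"
  valn :: "nat \<Rightarrow> 'a \<Rightarrow> int"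
  resmap :: "nat \<Rightarrow> 'a \<Rightarrow> 'a"

definition higher_local_field :: "nat \<Rightarrow> 'a local_tower \<Rightarrow> bool" where
  "higher_local_field n T \<longleftrightarrow>
     (\<forall>i\<le>n. field (level T i)) \<and>
     (\<forall>i \<in> {1..n}.
        discrete_valuation (level T i) (valn T i) \<and>
        valuation_complete (level T i) (valn T i) \<and>
        resmap T i \<in> ring_hom (valuation_ring (level T i) (valn T i)) (level T (i - 1)) \<and>
        resmap T i ` carrier (valuation_ring (level T i) (valn T i)) = carrier (level T (i - 1)) \<and>
        (\<forall>x \<in> carrier (valuation_ring (level T i) (valn T i)).
           resmap T i x = \<zero>\<^bsub>level T (i - 1)\<^esub> \<longleftrightarrow> val_ge (level T i) (valn T i) 1 x))"

primrec iterated_residue :: "'a local_tower \<Rightarrow> nat \<Rightarrow> nat \<Rightarrow> 'a \<Rightarrow> 'a" where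
  "iterated_residue T n 0 f = f"
| "iterated_residue T n (Suc s) f = resmap T (n - s) (iterated_residue T n s f)"

text \<open>
  The image of \<open>f\<close> in level \<open>j\<close> under successive reduction; meaningful only if the images of \<open>f\<close>
  in the levels above \<open>j\<close> all have valuation zero.
\<close>

definition image_in_level :: "nat \<Rightarrow> 'a local_tower \<Rightarrow> nat \<Rightarrow> 'a \<Rightarrow> 'a" where
  "image_in_level n T j f = iterated_residue T n (n - j) f"

definition rank_n_ring :: "nat \<Rightarrow> 'a local_tower \<Rightarrow> 'a set" where
  "rank_n_ring n T =
     {f \<in> carrier (level T n).
        val_ge (level T n) (valn T n) 1 f \<or>
        (\<exists>i \<in> {1..n - 1}.
           (\<forall>j \<in> {n - i + 1..n}. val_unit (level T j) (valn T j) (image_in_level n T j f)) \<and>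
           val_ge (level T (n - i)) (valn T (n - i)) 1 (image_in_level n T (n - i) f)) \<or>
        (\<forall>j \<in> {1..n}. val_unit (level T j) (valn T j) (image_in_level n T j f))}"

text \<open>
  \<open>S\<close> extends \<open>T\<close> along field embeddings \<open>\<iota> i\<close>, each finite, such that the valuations of \<open>S\<close>
  extend those of \<open>T\<close>.  The latter is expressed by valuation rings, since an extension of an
  integer valued valuation is again integer valued only after rescaling by a ramification index.
\<close>

definition finite_tower_extension ::
  "nat \<Rightarrow> 'a local_tower \<Rightarrow> 'b local_tower \<Rightarrow> (nat \<Rightarrow> 'a \<Rightarrow> 'b) \<Rightarrow> bool" where
  "finite_tower_extension n T S \<iota> \<longleftrightarrow>
     (\<forall>i\<le>n. \<iota> i \<in> ring_hom (level T i) (level S i) \<and>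
        ring.finite_dimension (level S i) (\<iota> i ` carrier (level T i)) (carrier (level S i))) \<and>
     (\<forall>i \<in> {1..n}. \<forall>x \<in> carrier (level T i).
        (val_ge (level S i) (valn S i) 0 (\<iota> i x) \<longleftrightarrow> val_ge (level T i) (valn T i) 0 x) \<and>
        (val_ge (level T i) (valn T i) 0 x \<longrightarrow>
           resmap S i (\<iota> i x) = \<iota> (i - 1) (resmap T i x)))"

section \<open>The rank n valuation on the algebraic closure\<close>

text \<open>
  The union, over the finite extensions \<open>L\<close> inside the algebraic closure, of the valuation rings
  \<open>rank_n_ring\<close> of \<open>L\<close>, where \<open>L\<close> carries its structure of a higher local field extending \<open>T\<close>.
\<close>

definition rank_n_ring_closure :: "nat \<Rightarrow> 'k::field local_tower \<Rightarrow> 'k alg_closure set" where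
  "rank_n_ring_closure n T =
     {x. \<exists>L S \<iota>. subfield L ring_of_type_algebra \<and> higher_local_field n S \<and>
           level S n = ring_of_type_algebra\<lparr>carrier := L\<rparr> \<and>
           finite_tower_extension n T S \<iota> \<and> \<iota> n = to_ac \<and> x \<in> rank_n_ring n S}"

text \<open>Nonnegativity in the lexicographic order with the last coordinate the most significant.\<close>

definition lex_nonneg :: "real ^ 'n::{finite,linorder} \<Rightarrow> bool" where
  "lex_nonneg x \<longleftrightarrow> x = 0 \<or> (\<exists>i. x $ i > 0 \<and> (\<forall>j>i. x $ j = 0))"

text \<open>
  \<open>\<nu>\<close> is the quotient map from the unit group of the algebraic closure onto \<open>\<Gamma>\<^sub>\<rat>\<close> (its quotient
  by the units of the valuation ring, ordered by that ring), composed with an identification of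
  \<open>\<Gamma>\<^sub>\<real>\<close> with the lexicographically ordered space \<open>real ^ 'n\<close> which maps the value group of the
  base field onto the integer points.  Such an identification is unique up to order automorphisms
  of the lattice of integer points.
\<close>

definition rank_n_valuation ::
  "nat \<Rightarrow> 'k::field local_tower \<Rightarrow> ('k alg_closure \<Rightarrow> real ^ 'n::{finite,linorder}) \<Rightarrow> bool" where
  "rank_n_valuation n T \<nu> \<longleftrightarrow>
     (\<forall>x y. x \<noteq> 0 \<longrightarrow> y \<noteq> 0 \<longrightarrow> \<nu> (x * y) = \<nu> x + \<nu> y) \<and>
     (\<forall>x. x \<noteq> 0 \<longrightarrow> (lex_nonneg (\<nu> x) \<longleftrightarrow> x \<in> rank_n_ring_closure n T)) \<and>
     (\<lambda>x. \<nu> (to_ac x)) ` (UNIV - {0}) = {z. \<forall>i. z $ i \<in> \<int>}"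

definition value_group :: "('k::field alg_closure \<Rightarrow> real ^ 'n) \<Rightarrow> (real ^ 'n) set" where
  "value_group \<nu> = \<nu> ` (UNIV - {0})"

section \<open>Hypersurfaces in the torus\<close>

text \<open>
  The ring of Laurent polynomials is the group algebra of the character lattice \<open>int ^ 'm\<close>, that is
  the type \<open>(int ^ 'm) \<Rightarrow>\<^sub>0 'k\<close> with its convolution product.
\<close>

definition eval_laurent ::
  "((int ^ 'm::finite) \<Rightarrow>\<^sub>0 'k::field) \<Rightarrow> 'k alg_closure ^ 'm \<Rightarrow> 'k alg_closure" where
  "eval_laurent f t =
     (\<Sum>u \<in> Poly_Mapping.keys f. to_ac (Poly_Mapping.lookup f u) * (\<Prod>j\<in>UNIV. (t $ j) powi (u $ j)))"

definition hypersurface_points ::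
  "((int ^ 'm::finite) \<Rightarrow>\<^sub>0 'k::field) \<Rightarrow> ('k alg_closure ^ 'm) set" where
  "hypersurface_points f = {t. (\<forall>j. t $ j \<noteq> 0) \<and> eval_laurent f t = 0}"

text \<open>The closed subset of the prime spectrum defined by \<open>I\<close>.\<close>

definition zariski_closed :: "'a::comm_ring_1 set \<Rightarrow> 'a set set" where
  "zariski_closed I = {P. primeideal P ring_of_type_algebra \<and> I \<subseteq> P}"

definition zariski_irreducible :: "'a::comm_ring_1 set set \<Rightarrow> bool" where
  "zariski_irreducible Z \<longleftrightarrow> Z \<noteq> {} \<and>
     (\<forall>I J. Z \<subseteq> zariski_closed I \<union> zariski_closed J \<longrightarrow>
        Z \<subseteq> zariski_closed I \<or> Z \<subseteq> zariski_closed J)"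

text \<open>
  The subscheme cut out by \<open>f\<close> is reduced if the quotient ring by \<open>f\<close> has no nonzero nilpotents,
  and irreducible if its underlying topological space is.
\<close>

definition reduced_irreducible_hypersurface :: "'a::comm_ring_1 \<Rightarrow> bool" where
  "reduced_irreducible_hypersurface f \<longleftrightarrow>
     f \<noteq> 0 \<and> (\<forall>g k. f dvd g ^ k \<longrightarrow> f dvd g) \<and> zariski_irreducible (zariski_closed {f})"

section \<open>Tropicalization and rational polyhedral complexes\<close>

definition tropicalization ::
  "('k::field alg_closure \<Rightarrow> real ^ 'n) \<Rightarrow> ('k alg_closure ^ 'm) set \<Rightarrow> (real ^ 'n ^ 'm) set" where
  "tropicalization \<nu> Y = closure ((\<lambda>t. \<chi> j. \<nu> (t $ j)) ` Y)"

text \<open>A rational structure is given by the set \<open>V\<close> of its rational points.\<close>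

definition rational_polyhedron :: "'a::euclidean_space set \<Rightarrow> 'a set \<Rightarrow> bool" where
  "rational_polyhedron V S \<longleftrightarrow>
     (\<exists>F. finite F \<and> S = \<Inter> F \<and>
        (\<forall>H\<in>F. \<exists>a b. a \<noteq> 0 \<and> (\<forall>v\<in>V. a \<bullet> v \<in> \<rat>) \<and> b \<in> \<rat> \<and> H = {x. a \<bullet> x \<le> b}))"

definition rational_polyhedral_complex :: "'a::euclidean_space set \<Rightarrow> 'a set set \<Rightarrow> bool" where
  "rational_polyhedral_complex V \<C> \<longleftrightarrow>
     finite \<C> \<and>
     (\<forall>S\<in>\<C>. rational_polyhedron V S) \<and>
     (\<forall>S F. S \<in> \<C> \<and> F face_of S \<longrightarrow> F \<in> \<C>) \<and>
     (\<forall>S S'. S \<in> \<C> \<and> S' \<in> \<C> \<longrightarrow> (S \<inter> S') face_of S)"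

definition complex_dimension :: "'a::euclidean_space set set \<Rightarrow> int \<Rightarrow> bool" where
  "complex_dimension \<C> d \<longleftrightarrow> (\<exists>S\<in>\<C>. aff_dim S = d) \<and> (\<forall>S\<in>\<C>. aff_dim S \<le> d)"

end

theory Submission
  imports Defs
begin

text \<open>
  The rank \<open>n\<close> valuation \<open>\<nu>\<close> is a Krull valuation on an algebraically closed field, and only this and
  the fact that its value group is the group of rational vectors matter.  By Kapranov's theorem the
  valuations of the points of the hypersurface are the rational points at which the lexicographic minimum
  of the affine functions \<open>\<nu>(a\<^sub>u) + u \<sqdot> p\<close>, one for each monomial of \<open>f\<close>, is attained at least twice.
  This set is a union of relatively open cells of the arrangement of rational hyperplanes on which a
  coordinate of two of these functions agrees.  Rational points are dense in every cell, so the closure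
  is the union of the closed cells.  Where two functions agree, \<open>n\<close> independent equations hold, which
  bounds the dimension; a suitable edge of the Newton polytope of \<open>f\<close> gives a cell of exactly this
  dimension.
\<close>

unbundle no Formal_Power_Series.fps_syntax

section \<open>The valuation ring of rank n\<close>

text \<open>Two elements of \<open>rank_n_ring_closure\<close> come with unrelated finite extensions
  and towers, so their sum would call for a common tower. The ultrametric inequality is therefore
  reduced to stability under adding \<open>1\<close>, which stays in the tower of the given element.

  For n at least 2 the value group is non-archimedean and lexicographic half-spaces are neither open
  nor closed, which separates the proof into two worlds. The algebra is done for an arbitrary
  linearly ordered value group, by following the position of a unique minimum through a product of
  linear factors. The geometry uses the real topology: a lexicographic condition depends only on the
  signs of the coordinates, so it is constant on the cells of an ordinary arrangement that treats
  each coordinate separately. Where an open condition is needed, strict positivity of the most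
  significant coordinate replaces lexicographic positivity.\<close>

lemma iterated_residue_Suc:
  "iterated_residue T (Suc n) (Suc s) f = iterated_residue T n s (resmap T (Suc n) f)"
  by (induction s) auto

lemma image_in_level_Suc:
  assumes "j \<le> n"
  shows "image_in_level (Suc n) T j f = image_in_level n T j (resmap T (Suc n) f)"
  unfolding image_in_level_def Suc_diff_le[OF assms] by (rule iterated_residue_Suc)

lemma higher_local_field_lower: "higher_local_field (Suc n) T \<Longrightarrow> higher_local_field n T"
  unfolding higher_local_field_def by (auto simp del: One_nat_def)

text \<open>The valuation ring is composite: the maximal ideal of the top valuation together with
  the units whose reduction lies in the ring one level below. This recursion replaces the list of
  index conditions in all later inductions.\<close>

lemma rank_n_ring_Suc:
  assumes T: "higher_local_field (Suc n) T" and n: "n \<ge> 1"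
  shows "f \<in> rank_n_ring (Suc n) T \<longleftrightarrow>
    f \<in> carrier (level T (Suc n)) \<and>
    (val_ge (level T (Suc n)) (valn T (Suc n)) 1 f \<or>
     val_unit (level T (Suc n)) (valn T (Suc n)) f \<and>
     resmap T (Suc n) f \<in> rank_n_ring n T)" (is "?L \<longleftrightarrow> ?R")
proof -
  define U where "U j = val_unit (level T j) (valn T j)" for j
  define G where "G j = val_ge (level T j) (valn T j) 1" for j
  define g where "g = resmap T (Suc n) f"
  have img: "image_in_level (Suc n) T j f = image_in_level n T j g" if "j \<le> n" for j
    using image_in_level_Suc[OF that] by (simp add: g_def)
  have top: "image_in_level (Suc n) T (Suc n) f = f" "image_in_level n T n g = g"
    by (simp_all add: image_in_level_def)
  have g: "g \<in> carrier (level T n)" if "f \<in> carrier (level T (Suc n))" "U (Suc n) f"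
  proof -
    have "f \<in> carrier (valuation_ring (level T (Suc n)) (valn T (Suc n)))"
      using that by (auto simp: valuation_ring_def val_ge_def val_unit_def U_def)
    moreover have "resmap T (Suc n) ` carrier (valuation_ring (level T (Suc n)) (valn T (Suc n))) =
      carrier (level T n)"
      using T by (auto simp: higher_local_field_def dest!: bspec[of _ _ "Suc n"])
    ultimately show ?thesis by (auto simp: g_def)
  qed
  have all: "(\<forall>j\<in>{Suc n - i + 1..Suc n}. U j (image_in_level (Suc n) T j f)) \<longleftrightarrow>
     U (Suc n) f \<and> (\<forall>j\<in>{n - (i - 1) + 1..n}. U j (image_in_level n T j g))" if "i \<ge> 1" "i \<le> Suc n" for i
  proof -
    have "{Suc n - i + 1..Suc n} = insert (Suc n) {n - (i - 1) + 1..n}"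
      using that by auto
    then show ?thesis using img top(1) by auto
  qed
  have ge: "(\<exists>i\<in>{1..n}. (\<forall>j\<in>{Suc n - i + 1..Suc n}. U j (image_in_level (Suc n) T j f)) \<and>
       G (Suc n - i) (image_in_level (Suc n) T (Suc n - i) f)) \<longleftrightarrow>
      U (Suc n) f \<and> (G n g \<or> (\<exists>i\<in>{1..n - 1}. (\<forall>j\<in>{n - i + 1..n}. U j (image_in_level n T j g)) \<and>
       G (n - i) (image_in_level n T (n - i) g)))" (is "?A \<longleftrightarrow> ?B")
  proof
    assume ?A
    then obtain i where i: "i \<in> {1..n}" "\<forall>j\<in>{Suc n - i + 1..Suc n}. U j (image_in_level (Suc n) T j f)"
      "G (Suc n - i) (image_in_level (Suc n) T (Suc n - i) f)" by auto
    then have "U (Suc n) f" "\<forall>j\<in>{n - (i - 1) + 1..n}. U j (image_in_level n T j g)"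
      "G (n - (i - 1)) (image_in_level n T (n - (i - 1)) g)"
      using all[of i] img[of "Suc n - i"] by auto
    \<comment> \<open>For \<open>i = 1\<close> the condition concerns the first residue
      \<open>g\<close> itself and matches the first alternative in the definition of
      \<open>rank_n_ring n T\<close>; larger \<open>i\<close> shift by one.\<close>
    moreover have "i - 1 = 0 \<or> i - 1 \<in> {1..n - 1}" using i(1) by auto
    ultimately show ?B using top(2) by (metis diff_zero)
  next
    assume B: ?B
    then consider "G n g" | i where "i\<in>{1..n - 1}" "\<forall>j\<in>{n - i + 1..n}. U j (image_in_level n T j g)"
       "G (n - i) (image_in_level n T (n - i) g)" by auto
    then show ?A
    proof cases
      case 1
      then show ?thesis using B n all[of 1] img[of n] top by (intro bexI[of _ 1]) auto
    next
      case 2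
      then show ?thesis using B n all[of "Suc i"] img[of "n - i"] by (intro bexI[of _ "Suc i"]) auto
    qed
  qed
  have un: "(\<forall>j\<in>{1..Suc n}. U j (image_in_level (Suc n) T j f)) \<longleftrightarrow>
      U (Suc n) f \<and> (\<forall>j\<in>{1..n}. U j (image_in_level n T j g))"
    using all[of "Suc n"] by simp
  show ?thesis
    unfolding rank_n_ring_def mem_Collect_eq
    unfolding U_def[symmetric] G_def[symmetric] g_def[symmetric]
    using ge un g by auto
qed

lemma rank_n_ring_1:
  assumes "higher_local_field 1 T"
  shows "f \<in> rank_n_ring 1 T \<longleftrightarrow> f \<in> carrier (valuation_ring (level T 1) (valn T 1))"
  by (auto simp: rank_n_ring_def image_in_level_def valuation_ring_def val_ge_def val_unit_def)

lemma discrete_valuation_one_add: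
  assumes "field R" "discrete_valuation R w"
  shows "w \<one>\<^bsub>R\<^esub> = 0"
    and "f \<in> carrier R \<Longrightarrow> val_ge R w 0 f \<Longrightarrow> val_ge R w 0 (\<one>\<^bsub>R\<^esub> \<oplus>\<^bsub>R\<^esub> f)"
proof -
  interpret field R by fact
  show w1: "w \<one>\<^bsub>R\<^esub> = 0"
    using assms(2) one_closed one_not_zero unfolding discrete_valuation_def
    by (metis DiffI l_one add_cancel_right_right singletonD)
  assume f: "f \<in> carrier R" "val_ge R w 0 f"
  show "val_ge R w 0 (\<one>\<^bsub>R\<^esub> \<oplus>\<^bsub>R\<^esub> f)"
  proof (cases "f = \<zero>\<^bsub>R\<^esub>")
    case True
    then show ?thesis using w1 by (simp add: val_ge_def)
  next
    case False
    then have "val_ge R w (min 0 (w f)) (\<one>\<^bsub>R\<^esub> \<oplus>\<^bsub>R\<^esub> f)"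
      using assms(2) w1 f unfolding discrete_valuation_def
      by (metis DiffI one_closed one_not_zero singletonD)
    then show ?thesis using f False by (auto simp: val_ge_def)
  qed
qed

text \<open>Reduction sends \<open>1 + f\<close> to \<open>1\<close> plus the reduction of
  \<open>f\<close>. If \<open>f\<close> has positive valuation this is just \<open>1\<close>, which
  is why membership of \<open>1\<close> is carried through the induction.\<close>

lemma rank_n_ring_one_add:
  assumes "higher_local_field n T" "n \<ge> 1"
  shows "\<one>\<^bsub>level T n\<^esub> \<in> rank_n_ring n T"
    and "f \<in> rank_n_ring n T \<Longrightarrow> \<one>\<^bsub>level T n\<^esub> \<oplus>\<^bsub>level T n\<^esub> f \<in> rank_n_ring n T"
proof -
  have "\<one>\<^bsub>level T n\<^esub> \<in> rank_n_ring n T \<and>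
    (\<forall>f. f \<in> rank_n_ring n T \<longrightarrow> \<one>\<^bsub>level T n\<^esub> \<oplus>\<^bsub>level T n\<^esub> f \<in> rank_n_ring n T)"
    using assms(2,1)
  proof (induction n rule: nat_induct_at_least)
    case base
    define R where "R = level T 1"
    define w where "w = valn T 1"
    have R: "field R" "discrete_valuation R w"
      using base by (auto simp: higher_local_field_def R_def w_def)
    interpret R: field R by fact
    show ?case
      using discrete_valuation_one_add[OF R]
      unfolding rank_n_ring_1[OF base] R_def[symmetric] w_def[symmetric]
      by (auto simp: valuation_ring_def val_ge_def)
  next
    case (Suc n)
    define R where "R = level T (Suc n)"
    define S where "S = level T n"
    define w where "w = valn T (Suc n)"
    define r where "r = resmap T (Suc n)"
    define V where "V = carrier (valuation_ring R w)"
    interpret R: field R using Suc.prems by (auto simp: higher_local_field_def R_def)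
    interpret S: field S using Suc.prems by (auto simp: higher_local_field_def S_def)
    have T: "discrete_valuation R w" "r \<in> ring_hom (valuation_ring R w) S"
      "x \<in> V \<Longrightarrow> r x = \<zero>\<^bsub>S\<^esub> \<longleftrightarrow> val_ge R w 1 x" for x
      using Suc.prems unfolding higher_local_field_def R_def S_def w_def r_def V_def
      by (auto dest!: bspec[of _ _ "Suc n"])
    have IH: "\<one>\<^bsub>S\<^esub> \<in> rank_n_ring n T"
      "f \<in> rank_n_ring n T \<Longrightarrow> \<one>\<^bsub>S\<^esub> \<oplus>\<^bsub>S\<^esub> f \<in> rank_n_ring n T" for f
      using Suc.IH higher_local_field_lower[OF Suc.prems] by (auto simp: S_def)
    have iff: "f \<in> rank_n_ring (Suc n) T \<longleftrightarrow> f \<in> carrier R \<and>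
        (val_ge R w 1 f \<or> val_unit R w f \<and> r f \<in> rank_n_ring n T)" for f
      using rank_n_ring_Suc[OF Suc.prems] Suc.hyps by (auto simp: R_def w_def r_def)
    have V_iff: "x \<in> V \<longleftrightarrow> x \<in> carrier R \<and> val_ge R w 0 x" for x
      by (auto simp: V_def valuation_ring_def)
    have oneV: "\<one>\<^bsub>R\<^esub> \<in> V"
      using discrete_valuation_one_add[OF R.field_axioms T(1)] by (auto simp: V_iff val_ge_def)
    have add: "\<one>\<^bsub>R\<^esub> \<oplus>\<^bsub>R\<^esub> f \<in> V" if "f \<in> V" for f
      using discrete_valuation_one_add[OF R.field_axioms T(1)] that by (auto simp: V_iff val_ge_def)
    have r1: "r \<one>\<^bsub>R\<^esub> = \<one>\<^bsub>S\<^esub>"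
      using ring_hom_one[OF T(2)] by (simp add: valuation_ring_def)
    have radd: "r (\<one>\<^bsub>R\<^esub> \<oplus>\<^bsub>R\<^esub> f) = \<one>\<^bsub>S\<^esub> \<oplus>\<^bsub>S\<^esub> r f" if "f \<in> V" for f
      using ring_hom_add[OF T(2), of "\<one>\<^bsub>R\<^esub>" f] that oneV r1
      by (simp add: V_def[symmetric]) (simp add: valuation_ring_def)
    \<comment> \<open>In positive valuation \<open>x\<close> belongs to the ring outright, in
      valuation zero through its reduction, so one test on \<open>r x\<close> serves both
      cases.\<close>
    have unit: "x \<in> rank_n_ring (Suc n) T" if "x \<in> V" "r x \<in> rank_n_ring n T" for x
      using that by (auto simp: iff V_iff val_ge_def val_unit_def)
    have "\<one>\<^bsub>R\<^esub> \<in> rank_n_ring (Suc n) T" using unit[OF oneV] IH(1) r1 by simp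
    moreover have "\<one>\<^bsub>R\<^esub> \<oplus>\<^bsub>R\<^esub> f \<in> rank_n_ring (Suc n) T" if f: "f \<in> rank_n_ring (Suc n) T" for f
    proof -
      have fV: "f \<in> V" using f by (auto simp: iff V_iff val_ge_def val_unit_def)
      have "\<one>\<^bsub>S\<^esub> \<oplus>\<^bsub>S\<^esub> r f \<in> rank_n_ring n T"
      proof (cases "val_ge R w 1 f")
        case True
        then show ?thesis using T(3)[OF fV] IH(1) by simp
      next
        case False
        then show ?thesis using f IH(2) by (auto simp: iff)
      qed
      then show ?thesis using unit[OF add[OF fV]] radd[OF fV] by simp
    qed
    ultimately show ?case by (auto simp: R_def)
  qed
  then show "\<one>\<^bsub>level T n\<^esub> \<in> rank_n_ring n T"
    and "f \<in> rank_n_ring n T \<Longrightarrow> \<one>\<^bsub>level T n\<^esub> \<oplus>\<^bsub>level T n\<^esub> f \<in> rank_n_ring n T" by auto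
qed

section \<open>Krull valuations on algebraically closed fields\<close>

locale krull_valuation =
  fixes v :: "'a::field \<Rightarrow> 'g::linordered_ab_group_add"
  assumes v_mult: "x \<noteq> 0 \<Longrightarrow> y \<noteq> 0 \<Longrightarrow> v (x * y) = v x + v y"
    and v_add: "x \<noteq> 0 \<Longrightarrow> y \<noteq> 0 \<Longrightarrow> x + y \<noteq> 0 \<Longrightarrow> min (v x) (v y) \<le> v (x + y)"
begin

text \<open>The value \<open>v 0\<close> is arbitrary; this predicate restores the convention that
  zero has infinite valuation.\<close>

definition vgt :: "'g \<Rightarrow> 'a \<Rightarrow> bool" where
  "vgt c x \<longleftrightarrow> x = 0 \<or> c < v x"

text \<open>Zero entries are allowed, so that the notion applies both to finite families of terms
  and to the whole coefficient sequence of a polynomial.\<close>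

definition unique_min :: "('u \<Rightarrow> 'a) \<Rightarrow> 'u set \<Rightarrow> bool" where
  "unique_min c U \<longleftrightarrow> (\<exists>u\<in>U. c u \<noteq> 0 \<and> (\<forall>w\<in>U - {u}. vgt (v (c u)) (c w)))"

section \<open>Dominant terms and unique minima\<close>

lemma v_one [simp]: "v 1 = 0"
  using v_mult[of 1 1] by simp

lemma v_minus [simp]: "v (- x) = v x"
proof (cases "x = 0")
  case False
  \<comment> \<open>An ordered abelian group has no torsion, so \<open>v (-1)\<close>
    vanishes.\<close>
  have "v (-1) + v (-1) = 0"
    using v_mult[of "-1" "-1"] by simp
  then have "v (-1) = 0" by (simp only: double_zero)
  then show ?thesis using v_mult[of "-1" x] False by simp
qed simp

lemma vgt_add: "vgt c x \<Longrightarrow> vgt c y \<Longrightarrow> vgt c (x + y)"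
  unfolding vgt_def using v_add[of x y]
  by (metis add.right_neutral add_0 less_le_trans min_less_iff_conj)

lemma vgt_sum: "(\<And>u. u \<in> U \<Longrightarrow> vgt c (f u)) \<Longrightarrow> vgt c (sum f U)"
  by (induction U rule: infinite_finite_induct) (auto intro: vgt_add simp: vgt_def[of c 0])

lemma add_vgt:
  assumes "x \<noteq> 0" "vgt (v x) y"
  shows "x + y \<noteq> 0" "v (x + y) = v x"
proof -
  show nz: "x + y \<noteq> 0"
    using assms by (metis add.inverse_unique less_irrefl v_minus vgt_def neg_equal_0_iff_equal)
  show "v (x + y) = v x"
  proof (cases "y = 0")
    case False
    then have less: "v x < v y" using assms by (simp add: vgt_def)
    then have "v x \<le> v (x + y)" using v_add[OF assms(1) False nz] by simp
    \<comment> \<open>\<open>x\<close> is the sum of \<open>x + y\<close> and \<open>- y\<close>. As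
      \<open>v y\<close> exceeds \<open>v x\<close>, the ultrametric bound on \<open>v x\<close>
      must come from \<open>x + y\<close>.\<close>
    moreover have "v (x + y) \<le> v x"
      using v_add[of "x + y" "- y"] nz False assms(1) less by (auto simp: min_le_iff_disj)
    ultimately show ?thesis by simp
  qed simp
qed

lemma sum_unique_min_nonzero:
  assumes "finite U" "unique_min c U"
  shows "sum c U \<noteq> 0"
proof -
  obtain u where u: "u \<in> U" "c u \<noteq> 0" "\<And>w. w \<in> U - {u} \<Longrightarrow> vgt (v (c u)) (c w)"
    using assms(2) by (auto simp: unique_min_def)
  have "c u + sum c (U - {u}) \<noteq> 0"
    by (rule add_vgt(1)[OF u(2) vgt_sum]) (use u(3) in auto)
  then show ?thesis using assms(1) u(1) by (simp add: sum.remove[of U u c])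
qed

text \<open>A minimum exists by finiteness, so non-uniqueness can only mean a second index with the
  same value. The tie has the shape in which \<open>tropical_locus\<close> is defined.\<close>

lemma not_unique_min_iff:
  assumes U: "finite U" "U \<noteq> {}" and c: "\<And>u. u \<in> U \<Longrightarrow> c u \<noteq> 0"
  shows "\<not> unique_min c U \<longleftrightarrow>
    (\<exists>u\<in>U. \<exists>w\<in>U. u \<noteq> w \<and> v (c u) = v (c w) \<and> (\<forall>x\<in>U. v (c u) \<le> v (c x)))" (is "_ \<longleftrightarrow> ?tie")
proof
  assume nu: "\<not> unique_min c U"
  obtain u where u: "u \<in> U" "\<forall>x\<in>U. v (c u) \<le> v (c x)"
    using ex_is_arg_min_if_finite[OF U, of "\<lambda>u. v (c u)"] unfolding is_arg_min_linorder by blast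
  have "\<not> (\<forall>w\<in>U - {u}. vgt (v (c u)) (c w))"
    using nu u(1) c[OF u(1)] unfolding unique_min_def by blast
  then obtain w where w: "w \<in> U" "w \<noteq> u" "\<not> vgt (v (c u)) (c w)" by auto
  have "v (c w) \<le> v (c u)" using w(3) by (simp add: vgt_def not_less)
  moreover have "v (c u) \<le> v (c w)" using u(2) w(1) by blast
  ultimately have "v (c u) = v (c w)" by (rule antisym[rotated])
  then show ?tie using u w(1,2) by (intro bexI[of _ u] bexI[of _ w] conjI) simp_all
next
  assume ?tie
  then obtain u w where uw: "u \<in> U" "w \<in> U" "u \<noteq> w" "v (c u) = v (c w)" "\<forall>x\<in>U. v (c u) \<le> v (c x)"
    by (elim bexE conjE)
  show "\<not> unique_min c U"
  proof
    assume "unique_min c U"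
    then obtain a where a: "a \<in> U" "\<forall>x\<in>U - {a}. vgt (v (c a)) (c x)"
      unfolding unique_min_def by (elim bexE conjE)
    \<comment> \<open>Whichever of the two tied indices differs from \<open>a\<close>; its value is
      minimal, hence not above \<open>v (c a)\<close>.\<close>
    define b where "b = (if u = a then w else u)"
    have b: "b \<in> U" "b \<noteq> a" using uw(1-3) by (auto simp: b_def)
    have "v (c b) \<le> v (c a)" using uw(4,5) a(1) by (simp add: b_def)
    moreover have "vgt (v (c a)) (c b)" using a(2) b by blast
    ultimately show False using c[OF b(1)] by (simp add: vgt_def)
  qed
qed

text \<open>After rescaling, a unique minimum says that the reduction of \<open>p\<close> is a
  monomial. The factor \<open>X - r\<close> reduces to \<open>X\<close> if \<open>r = 0\<close> or
  \<open>v r > 0\<close>, and is dominated by its constant term if \<open>v r < 0\<close>. So the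
  minimum moves from \<open>a\<close> to \<open>Suc a\<close> in the first case and stays at
  \<open>a\<close> in the second.\<close>

lemma unique_min_mult_linear:
  assumes p: "unique_min (poly.coeff p) UNIV" and r: "r = 0 \<or> v r \<noteq> 0"
  shows "unique_min (poly.coeff ([:- r, 1:] * p)) UNIV"
proof -
  obtain a where a: "poly.coeff p a \<noteq> 0" "\<And>i. i \<noteq> a \<Longrightarrow> vgt (v (poly.coeff p a)) (poly.coeff p i)"
    using p by (auto simp: unique_min_def)
  define q where "q = [:- r, 1:] * p"
  \<comment> \<open>The coefficients of \<open>X * p\<close>, so that \<open>q\<close> is the sum of
    a shifted and a scaled copy of \<open>p\<close>.\<close>
  define d where "d i = (if i = 0 then 0 else poly.coeff p (i - 1))" for i
  have q: "poly.coeff q i = d i + - (r * poly.coeff p i)" for i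
    by (simp add: q_def d_def coeff_pCons split: nat.split)
  have d: "vgt (v (poly.coeff p a)) (d i)" if "i \<noteq> Suc a" for i
    using a(2)[of "i - 1"] that by (auto simp: d_def vgt_def[of _ 0])
  consider "r = 0 \<or> 0 < v r" | "r \<noteq> 0" "v r < 0" using r by fastforce
  then have "\<exists>b. poly.coeff q b \<noteq> 0 \<and> (\<forall>i. i \<noteq> b \<longrightarrow> vgt (v (poly.coeff q b)) (poly.coeff q i))"
  proof cases
    case 1
    have rp: "vgt (v (poly.coeff p a)) (- (r * poly.coeff p i))" for i
    proof (cases "r = 0 \<or> poly.coeff p i = 0")
      case False
      have "v (poly.coeff p a) \<le> v (poly.coeff p i)"
        using a(2)[of i] False by (cases "i = a") (auto simp: vgt_def)
      then have "v (poly.coeff p a) < v r + v (poly.coeff p i)"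
        using 1 False by (metis add_0 add_less_le_mono)
      then show ?thesis using False by (simp add: vgt_def v_mult)
    qed (auto simp: vgt_def)
    have b: "poly.coeff q (Suc a) \<noteq> 0" "v (poly.coeff q (Suc a)) = v (poly.coeff p a)"
      using add_vgt[OF a(1) rp[of "Suc a"]] by (auto simp: q d_def)
    have "vgt (v (poly.coeff p a)) (poly.coeff q i)" if "i \<noteq> Suc a" for i
      unfolding q by (rule vgt_add[OF d[OF that] rp])
    then show ?thesis using b by metis
  next
    case 2
    define c where "c = v r + v (poly.coeff p a)"
    have dc: "vgt c (d i)" for i
    proof (cases "d i = 0")
      case False
      have "v (poly.coeff p a) \<le> v (d i)"
        using d[of i] False by (cases "i = Suc a") (auto simp: vgt_def d_def)
      then have "c < v (d i)"
        using 2 unfolding c_def by (metis add_0 add_less_le_mono)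
      then show ?thesis by (simp add: vgt_def)
    qed (auto simp: vgt_def)
    have vc: "v (- (r * poly.coeff p a)) = c" using 2 a(1) by (simp add: c_def v_mult)
    have b: "poly.coeff q a \<noteq> 0" "v (poly.coeff q a) = c"
      using add_vgt[of "- (r * poly.coeff p a)" "d a"] 2 a(1) dc[of a] vc
      by (auto simp: q add.commute)
    have "vgt c (poly.coeff q i)" if "i \<noteq> a" for i
    proof -
      have "vgt c (- (r * poly.coeff p i))"
        using a(2)[OF that] 2 by (cases "poly.coeff p i = 0") (auto simp: vgt_def c_def v_mult)
      then show ?thesis unfolding q by (intro vgt_add dc)
    qed
    then show ?thesis using b by metis
  qed
  then show ?thesis by (auto simp: unique_min_def q_def)
qed

end

text \<open>Gauss' lemma, applied to the factorization into linear factors.\<close>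

lemma unique_min_coeff_if_no_root:
  fixes v :: "'a::alg_closed_field \<Rightarrow> 'g::linordered_ab_group_add"
  assumes "krull_valuation v" and p: "p \<noteq> 0"
    and roots: "\<And>r. poly p r = 0 \<Longrightarrow> r = 0 \<or> v r \<noteq> 0"
  shows "krull_valuation.unique_min v (poly.coeff p) UNIV"
proof -
  interpret krull_valuation v by fact
  obtain A where A: "p = Polynomial.smult (Polynomial.lead_coeff p) (\<Prod>x\<in>#A. [:- x, 1:])"
    using alg_closed_imp_factorization[OF p] by blast
  define l where "l = Polynomial.lead_coeff p"
  have l: "l \<noteq> 0" using p by (simp add: l_def)
  have "x = 0 \<or> v x \<noteq> 0" if "x \<in># A" for x
  proof (rule roots)
    show "poly p x = 0"
      using that by (subst A) (auto simp: poly_prod_mset prod_mset_zero_iff intro!: bexI[of _ x])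
  qed
  then have "unique_min (poly.coeff (Polynomial.smult l (\<Prod>x\<in>#A. [:- x, 1:]))) UNIV"
  proof (induction A)
    case empty
    show ?case using l by (auto simp: unique_min_def vgt_def coeff_pCons split: nat.split intro!: exI[of _ 0])
  next
    case (add x A)
    have "unique_min (poly.coeff (Polynomial.smult l (\<Prod>x\<in>#A. [:- x, 1:]))) UNIV"
      by (rule add.IH) (use add.prems in simp)
    then have "unique_min (poly.coeff ([:- x, 1:] * Polynomial.smult l (\<Prod>x\<in>#A. [:- x, 1:]))) UNIV"
      by (rule unique_min_mult_linear) (use add.prems in simp)
    then show ?case by (simp only: mult_smult_right image_mset_add_mset prod_mset.add_mset)
  qed
  then show ?thesis using A by (simp add: l_def)
qed

text \<open>Contrapositive of the preceding lemma, after dividing by the lowest power of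
  \<open>s\<close>. Injectivity of \<open>e\<close> keeps distinct terms apart, so the polynomial
  has exactly the \<open>c u\<close> as nonzero coefficients and inherits the tie.\<close>

lemma laurent_root_of_valuation_zero:
  fixes v :: "'a::alg_closed_field \<Rightarrow> 'g::linordered_ab_group_add" and e :: "'u \<Rightarrow> int"
  assumes "krull_valuation v" and U: "finite U" "U \<noteq> {}" and e: "inj_on e U"
    and c: "\<And>u. u \<in> U \<Longrightarrow> c u \<noteq> 0" and nu: "\<not> krull_valuation.unique_min v c U"
  shows "\<exists>s. s \<noteq> 0 \<and> v s = 0 \<and> (\<Sum>u\<in>U. c u * s powi e u) = 0"
proof -
  interpret krull_valuation v by fact
  define m where "m = Min (e ` U)"
  define k where "k u = nat (e u - m)" for u
  have k: "int (k u) = e u - m" if "u \<in> U" for u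
    using U that by (simp add: k_def m_def)
  have k_inj: "k u = k w \<longleftrightarrow> u = w" if "u \<in> U" "w \<in> U" for u w
    using k[OF that(1)] k[OF that(2)] e that by (auto simp: inj_on_def)
  define p where "p = (\<Sum>u\<in>U. Polynomial.monom (c u) (k u))"
  have coeff_p: "poly.coeff p (k u) = c u" if "u \<in> U" for u
  proof -
    have "poly.coeff p (k u) = (\<Sum>w\<in>U. if w = u then c w else 0)"
      unfolding p_def coeff_sum coeff_monom by (intro sum.cong) (use that k_inj in auto)
    then show ?thesis using U that by simp
  qed
  have "p \<noteq> 0" using U(2) c coeff_p by (metis all_not_in_conv coeff_0)
  have "\<not> unique_min (poly.coeff p) UNIV"
  proof
    assume "unique_min (poly.coeff p) UNIV"
    then obtain a where a: "poly.coeff p a \<noteq> 0" "\<And>i. i \<noteq> a \<Longrightarrow> vgt (v (poly.coeff p a)) (poly.coeff p i)"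
      by (auto simp: unique_min_def)
    have "\<exists>u\<in>U. k u = a"
    proof (rule ccontr)
      assume "\<not> ?thesis"
      then have "poly.coeff p a = 0" unfolding p_def coeff_sum coeff_monom by (intro sum.neutral) auto
      with a show False by simp
    qed
    then obtain u where u: "u \<in> U" "a = k u" by auto
    have "vgt (v (c u)) (c w)" if "w \<in> U - {u}" for w
      using a(2)[of "k w"] that u k_inj[of w u] coeff_p by auto
    then show False using nu u c by (auto simp: unique_min_def)
  qed
  then obtain s where s: "poly p s = 0" "s \<noteq> 0" "v s = 0"
    using unique_min_coeff_if_no_root[OF assms(1) \<open>p \<noteq> 0\<close>] by blast
  have "(\<Sum>u\<in>U. c u * s powi e u) = (\<Sum>u\<in>U. s powi m * (c u * s ^ k u))"
  proof (intro sum.cong refl)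
    fix u assume "u \<in> U"
    then have "s powi e u = s powi m * s powi int (k u)"
      using s(2) by (simp add: k flip: power_int_add)
    then show "c u * s powi e u = s powi m * (c u * s ^ k u)" by simp
  qed
  also have "\<dots> = s powi m * poly p s"
    by (simp add: p_def poly_sum poly_monom sum_distrib_left)
  finally show ?thesis using s by auto
qed

section \<open>Complexes of cells of a hyperplane arrangement\<close>

text \<open>A face of the arrangement whose hyperplanes have the normals and offsets in
  \<open>G\<close>. It is named by a point instead of a sign vector, so every cell is nonempty and a
  set of base points can select cells.\<close>

definition closed_cell :: "('a::euclidean_space \<times> real) set \<Rightarrow> 'a \<Rightarrow> 'a set" where
  "closed_cell G x = {y. \<forall>(a, b)\<in>G. (a \<bullet> x \<le> b \<longrightarrow> a \<bullet> y \<le> b) \<and> (b \<le> a \<bullet> x \<longrightarrow> b \<le> a \<bullet> y)}"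

definition open_cell :: "('a::euclidean_space \<times> real) set \<Rightarrow> 'a \<Rightarrow> 'a set" where
  "open_cell G x = {y. \<forall>(a, b)\<in>G. sgn (a \<bullet> y - b) = sgn (a \<bullet> x - b)}"

lemma mem_closed_cell:
  "y \<in> closed_cell G x \<longleftrightarrow>
    (\<forall>a b. (a, b) \<in> G \<longrightarrow> (a \<bullet> x \<le> b \<longrightarrow> a \<bullet> y \<le> b) \<and> (b \<le> a \<bullet> x \<longrightarrow> b \<le> a \<bullet> y))"
  by (auto simp: closed_cell_def)

lemma closed_cell_alt:
  "closed_cell G x = {y. \<forall>(a, b)\<in>G. a \<bullet> y = b \<or> sgn (a \<bullet> y - b) = sgn (a \<bullet> x - b)}"
proof -
  have "(s \<le> b \<longrightarrow> t \<le> b) \<and> (b \<le> s \<longrightarrow> b \<le> t) \<longleftrightarrow> t = b \<or> sgn (t - b) = sgn (s - b)" for s t b :: real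
    by (auto simp: sgn_real_def)
  then show ?thesis by (simp add: closed_cell_def)
qed

section \<open>Faces and intersections of closed cells\<close>

lemma finite_closed_cells:
  assumes "finite G"
  shows "finite (range (closed_cell G))"
proof (rule finite_subset)
  let ?f = "\<lambda>(P, Q). {y. (\<forall>(a, b)\<in>P. a \<bullet> y \<le> b) \<and> (\<forall>(a, b)\<in>Q. b \<le> a \<bullet> y)}"
  show "range (closed_cell G) \<subseteq> ?f ` (Pow G \<times> Pow G)"
  proof clarify
    fix x
    have "closed_cell G x = ?f ({(a, b)\<in>G. a \<bullet> x \<le> b}, {(a, b)\<in>G. b \<le> a \<bullet> x})"
      by (auto simp: closed_cell_def)
    then show "closed_cell G x \<in> ?f ` (Pow G \<times> Pow G)" by (rule image_eqI) auto
  qed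
  show "finite (?f ` (Pow G \<times> Pow G))" using assms by auto
qed

lemma mem_closed_cell_self [simp]: "x \<in> closed_cell G x"
  by (auto simp: closed_cell_def)

lemma convex_closed_cell: "convex (closed_cell G x)"
proof -
  have "closed_cell G x = (\<Inter>(a, b)\<in>G. (if a \<bullet> x \<le> b then {y. a \<bullet> y \<le> b} else UNIV) \<inter>
     (if b \<le> a \<bullet> x then {y. a \<bullet> y \<ge> b} else UNIV))"
    by (auto simp: closed_cell_def split: if_splits)
  also have "convex \<dots>"
    by (intro convex_INT) (auto intro!: convex_Int simp: convex_halfspace_le convex_halfspace_ge)
  finally show ?thesis .
qed

text \<open>The cell lies on one side of every hyperplane of \<open>G\<close>, so each hyperplane in
  \<open>H\<close> is a supporting one.\<close>

lemma closed_cell_Int_hyperplanes_face: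
  assumes "H \<subseteq> G"
  shows "{y\<in>closed_cell G x. \<forall>(a, b)\<in>H. a \<bullet> y = b} face_of closed_cell G x"
proof -
  have "(closed_cell G x \<inter> {y. a \<bullet> y = b}) face_of closed_cell G x" if "(a, b) \<in> H" for a b
  proof (cases "a \<bullet> x \<le> b")
    case True
    then show ?thesis using that assms
      by (intro face_of_Int_supporting_hyperplane_le convex_closed_cell) (auto simp: closed_cell_def)
  next
    case False
    then show ?thesis using that assms
      by (intro face_of_Int_supporting_hyperplane_ge convex_closed_cell) (auto simp: closed_cell_def)
  qed
  then have "\<Inter>(insert (closed_cell G x) ((\<lambda>(a, b). closed_cell G x \<inter> {y. a \<bullet> y = b}) ` H)) face_of
       closed_cell G x"
    by (intro face_of_Inter) (auto intro: face_of_refl convex_closed_cell)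
  also have "\<Inter>(insert (closed_cell G x) ((\<lambda>(a, b). closed_cell G x \<inter> {y. a \<bullet> y = b}) ` H)) =
      {y\<in>closed_cell G x. \<forall>(a, b)\<in>H. a \<bullet> y = b}"
    by auto
  finally show ?thesis .
qed

text \<open>Where the signs at \<open>x\<close> and \<open>y\<close> differ, a common point must lie
  on the hyperplane; where they agree, the two conditions coincide.\<close>

lemma closed_cell_Int_face: "closed_cell G x \<inter> closed_cell G y face_of closed_cell G x"
proof -
  have "closed_cell G x \<inter> closed_cell G y =
    {z\<in>closed_cell G x. \<forall>(a, b)\<in>{(a, b)\<in>G. sgn (a \<bullet> x - b) \<noteq> sgn (a \<bullet> y - b)}. a \<bullet> z = b}"
    unfolding closed_cell_alt by fastforce
  then show ?thesis by (simp only:) (rule closed_cell_Int_hyperplanes_face, auto)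
qed

lemma closed_cell_face:
  assumes "y \<in> closed_cell G x"
  shows "closed_cell G y face_of closed_cell G x"
proof -
  have "closed_cell G y \<subseteq> closed_cell G x"
    using assms by (intro subsetI) (simp add: mem_closed_cell)
  then show ?thesis using closed_cell_Int_face[of G x y] by (simp add: Int_absorb1)
qed

lemma eventually_open_halfspaces:
  assumes "finite G"
  shows "\<forall>\<^sub>F y in nhds x. \<forall>(a, b)\<in>G. a \<bullet> x \<noteq> b \<longrightarrow> sgn (a \<bullet> y - b) = sgn (a \<bullet> x - b)"
proof -
  have "\<forall>\<^sub>F y in nhds x. a \<bullet> x \<noteq> b \<longrightarrow> sgn (a \<bullet> y - b) = sgn (a \<bullet> x - b)" for a b
  proof -
    have "((\<lambda>y. a \<bullet> y) \<longlongrightarrow> a \<bullet> x) (nhds x)"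
      by (intro tendsto_intros filterlim_ident)
    note lim = order_tendstoD[OF this]
    consider "a \<bullet> x = b" | "a \<bullet> x < b" | "b < a \<bullet> x" by linarith
    then show ?thesis
    proof cases
      case 2
      then show ?thesis by (intro eventually_mono[OF lim(2)]) auto
    next
      case 3
      then show ?thesis by (intro eventually_mono[OF lim(1)]) auto
    qed simp
  qed
  then show ?thesis
    using assms by (auto simp: eventually_ball_finite_distrib)
qed

text \<open>A relative interior point \<open>y\<close> of \<open>F\<close> serves. Its cell is a
  face of the big cell meeting the relative interior of \<open>F\<close>, hence contains
  \<open>F\<close>. Conversely, the segment from a point \<open>z\<close> of that cell to
  \<open>y\<close> can be prolonged slightly beyond \<open>y\<close> inside the cell, and the face
  property then puts \<open>z\<close> into \<open>F\<close>.\<close>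

lemma face_of_closed_cell:
  assumes G: "finite G" and F: "F face_of closed_cell G x" "F \<noteq> {}"
  obtains y where "y \<in> F" "F = closed_cell G y"
proof -
  have "convex F" using F(1) by (rule face_of_imp_convex)
  then obtain y where y: "y \<in> rel_interior F"
    using F(2) rel_interior_eq_empty by blast
  have yF: "y \<in> F" using y rel_interior_subset by auto
  have yx: "y \<in> closed_cell G x" using yF F(1) face_of_imp_subset by blast
  have "F \<subseteq> closed_cell G y"
  proof (rule subset_of_face_of[OF closed_cell_face[OF yx]])
    show "F \<subseteq> closed_cell G x" using F(1) by (rule face_of_imp_subset)
    have "y \<in> closed_cell G y \<inter> rel_interior F" using y by simp
    then show "closed_cell G y \<inter> rel_interior F \<noteq> {}" by blast
  qed
  moreover have "z \<in> F" if z: "z \<in> closed_cell G y" for z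
  proof (cases "z = y")
    case False
    let ?w = "\<lambda>t. y + t *\<^sub>R (y - z)"
    have "(?w \<longlongrightarrow> ?w 0) (at_right 0)" by (intro tendsto_intros)
    then have "(?w \<longlongrightarrow> y) (at_right 0)" by simp
    then have "\<forall>\<^sub>F t in at_right 0. \<forall>(a, b)\<in>G. a \<bullet> y \<noteq> b \<longrightarrow> sgn (a \<bullet> ?w t - b) = sgn (a \<bullet> y - b)"
      by (rule eventually_compose_filterlim[OF eventually_open_halfspaces[OF G, of y]])
    then have "\<forall>\<^sub>F t in at_right 0. t > 0 \<and> (\<forall>(a, b)\<in>G. a \<bullet> y \<noteq> b \<longrightarrow> sgn (a \<bullet> ?w t - b) = sgn (a \<bullet> y - b))"
      by (intro eventually_conj eventually_at_right_less)
    then have "\<exists>t. t > 0 \<and> (\<forall>(a, b)\<in>G. a \<bullet> y \<noteq> b \<longrightarrow> sgn (a \<bullet> ?w t - b) = sgn (a \<bullet> y - b))"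
      by (rule eventually_happens'[OF trivial_limit_at_right_real])
    then obtain t :: real where t: "t > 0"
       and w: "\<forall>(a, b)\<in>G. a \<bullet> y \<noteq> b \<longrightarrow> sgn (a \<bullet> ?w t - b) = sgn (a \<bullet> y - b)"
      by (elim exE conjE)
    \<comment> \<open>Hyperplanes through \<open>y\<close> also contain \<open>z\<close>, hence the
      whole line; the others keep their sign for the small \<open>t\<close> chosen.\<close>
    have "?w t \<in> closed_cell G y"
      unfolding closed_cell_alt
    proof clarify
      fix a b assume ab: "(a, b) \<in> G" "sgn (a \<bullet> ?w t - b) \<noteq> sgn (a \<bullet> y - b)"
      then have ay: "a \<bullet> y = b" using bspec[OF w ab(1)] by auto
      then have "a \<bullet> z \<le> b \<and> b \<le> a \<bullet> z" using z ab(1) unfolding mem_closed_cell by simp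
      then have "a \<bullet> z = b" by simp
      then show "a \<bullet> ?w t = b" using ay by (simp add: inner_add_right inner_diff_right)
    qed
    then have "?w t \<in> closed_cell G x"
      using closed_cell_face[OF yx] face_of_imp_subset by blast
    moreover have "z \<in> closed_cell G x"
      using closed_cell_face[OF yx] face_of_imp_subset z by blast
    moreover have "y \<in> open_segment z (?w t)"
    proof -
      \<comment> \<open>The weight of \<open>?w t\<close> when \<open>y\<close> is written as a
        convex combination of \<open>z\<close> and \<open>?w t\<close>.\<close>
      define u where "u = 1 / (1 + t)"
      have u: "u + u * t = 1" "0 < u" "u < 1" using t by (simp_all add: u_def field_simps)
      have "(1 - u) *\<^sub>R z + u *\<^sub>R ?w t = (1 - (u + u * t)) *\<^sub>R z + (u + u * t) *\<^sub>R y"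
        by (simp add: algebra_simps)
      then have "y = (1 - u) *\<^sub>R z + u *\<^sub>R ?w t" unfolding u(1) by simp
      moreover have "z \<noteq> ?w t"
      proof
        assume "z = ?w t"
        then have "(1 + t) *\<^sub>R (y - z) = 0" by (simp add: algebra_simps)
        then show False using t False by auto
      qed
      ultimately show ?thesis unfolding in_segment using u(2,3) by blast
    qed
    ultimately show ?thesis using face_ofD[OF F(1)] yF by blast
  qed (use yF in simp)
  ultimately show thesis using that yF by blast
qed

lemma rational_polyhedron_closed_cell:
  assumes G: "finite G" "\<And>a b. (a, b) \<in> G \<Longrightarrow> a \<noteq> 0 \<and> (\<forall>v\<in>V. a \<bullet> v \<in> \<rat>) \<and> b \<in> \<rat>"
  shows "rational_polyhedron V (closed_cell G x)"
proof -
  define P where "P = {g\<in>G. fst g \<bullet> x \<le> snd g}"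
  define Q where "Q = {g\<in>G. snd g \<le> fst g \<bullet> x}"
  define F where "F = (\<lambda>g. {y. fst g \<bullet> y \<le> snd g}) ` P \<union> (\<lambda>g. {y. (- fst g) \<bullet> y \<le> - snd g}) ` Q"
  have "finite F"
    using G(1) by (simp add: F_def P_def Q_def)
  moreover have "closed_cell G x = \<Inter> F"
    by (simp add: F_def P_def Q_def Inter_Un_distrib closed_cell_def case_prod_unfold) auto
  moreover have "\<exists>a b. a \<noteq> 0 \<and> (\<forall>v\<in>V. a \<bullet> v \<in> \<rat>) \<and> b \<in> \<rat> \<and> H = {x. a \<bullet> x \<le> b}" if H: "H \<in> F" for H
  proof -
    obtain a b where ab: "(a, b) \<in> G" "H = {y. a \<bullet> y \<le> b} \<or> H = {y. (- a) \<bullet> y \<le> - b}"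
      using H by (auto simp: F_def P_def Q_def)
    have rat: "a \<noteq> 0 \<and> (\<forall>v\<in>V. a \<bullet> v \<in> \<rat>) \<and> b \<in> \<rat>"
      using G(2)[OF ab(1)] .
    show ?thesis using ab(2)
    proof
      assume "H = {y. a \<bullet> y \<le> b}"
      then show ?thesis using rat by (intro exI[of _ a] exI[of _ b]) simp
    next
      assume "H = {y. (- a) \<bullet> y \<le> - b}"
      then show ?thesis using rat by (intro exI[of _ "- a"] exI[of _ "- b"]) simp
    qed
  qed
  ultimately show ?thesis unfolding rational_polyhedron_def by (intro exI[of _ F] conjI ballI)
qed

text \<open>The empty set is a face of every cell, so it must be rational as well. Half-spaces need
  a nonzero normal, hence two contradictory half-spaces with opposite normals.\<close>

lemma rational_polyhedron_empty:
  assumes "a \<noteq> 0" "\<And>v. v \<in> V \<Longrightarrow> a \<bullet> v \<in> \<rat>"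
  shows "rational_polyhedron V {}"
  unfolding rational_polyhedron_def
proof (intro exI[of _ "{{x. a \<bullet> x \<le> -1}, {x. (- a) \<bullet> x \<le> -1}}"] conjI ballI)
  fix H assume "H \<in> {{x. a \<bullet> x \<le> -1}, {x. (- a) \<bullet> x \<le> -1}}"
  then consider "H = {x. a \<bullet> x \<le> -1}" | "H = {x. (- a) \<bullet> x \<le> -1}" by auto
  then show "\<exists>a b. a \<noteq> 0 \<and> (\<forall>v\<in>V. a \<bullet> v \<in> \<rat>) \<and> b \<in> \<rat> \<and> H = {x. a \<bullet> x \<le> b}"
  proof cases
    case 1
    then show ?thesis using assms by (intro exI[of _ a] exI[of _ "-1"]) auto
  next
    case 2
    then show ?thesis using assms by (intro exI[of _ "-a"] exI[of _ "-1"]) auto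
  qed
qed auto

text \<open>Faces are added because \<open>T\<close> need not be closed: a proper face of a selected
  cell may be a cell with base points outside \<open>T\<close>. The empty face enters too.\<close>

definition cell_complex :: "('a::euclidean_space \<times> real) set \<Rightarrow> 'a set \<Rightarrow> 'a set set" where
  "cell_complex G T = {F. \<exists>x\<in>T. F face_of closed_cell G x}"

lemma Union_cell_complex: "\<Union>(cell_complex G T) = (\<Union>x\<in>T. closed_cell G x)"
  by (auto simp: cell_complex_def intro: face_of_refl convex_closed_cell dest: face_of_imp_subset)

lemma rational_polyhedral_complex_cell_complex:
  assumes G: "finite G" "\<And>a b. (a, b) \<in> G \<Longrightarrow> a \<noteq> 0 \<and> (\<forall>v\<in>V. a \<bullet> v \<in> \<rat>) \<and> b \<in> \<rat>"
    and nonempty: "G \<noteq> {}"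
  shows "rational_polyhedral_complex V (cell_complex G T)"
proof -
  have cell: "F = {} \<or> (\<exists>y. F = closed_cell G y)" if "F \<in> cell_complex G T" for F
    using that face_of_closed_cell[OF G(1)] unfolding cell_complex_def by blast
  obtain a0 b0 where ab: "(a0, b0) \<in> G" using nonempty by auto
  have "finite (cell_complex G T)"
    by (rule finite_subset[of _ "insert {} (range (closed_cell G))"])
      (use cell finite_closed_cells[OF G(1)] in auto)
  moreover have "rational_polyhedron V F" if "F \<in> cell_complex G T" for F
    using cell[OF that] rational_polyhedron_closed_cell[OF G] rational_polyhedron_empty[of a0 V] G(2)[OF ab]
    by auto
  moreover have "F' \<in> cell_complex G T" if "F \<in> cell_complex G T" "F' face_of F" for F F'
    using that face_of_trans unfolding cell_complex_def by blast
  moreover have "F \<inter> F' face_of F" if "F \<in> cell_complex G T" "F' \<in> cell_complex G T" for F F'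
    using cell[OF that(1)] cell[OF that(2)] closed_cell_Int_face by (auto simp: empty_face_of)
  ultimately show ?thesis unfolding rational_polyhedral_complex_def by blast
qed

section \<open>Density of the rational points in the cells\<close>

text \<open>The equations are eliminated one at a time: \<open>\<Phi>\<close> is corrected in a rational direction along
  which the earlier equations hold and the new one does not.\<close>

lemma rational_retraction:
  fixes V :: "'a::euclidean_space set"
  assumes V: "closure V = UNIV" "\<And>u v. u \<in> V \<Longrightarrow> v \<in> V \<Longrightarrow> u - v \<in> V"
      "\<And>q v. q \<in> \<rat> \<Longrightarrow> v \<in> V \<Longrightarrow> q *\<^sub>R v \<in> V"
    and G: "finite G" "\<And>a b. (a, b) \<in> G \<Longrightarrow> (\<forall>v\<in>V. a \<bullet> v \<in> \<rat>) \<and> b \<in> \<rat>"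
    and x: "\<And>a b. (a, b) \<in> G \<Longrightarrow> a \<bullet> x = b"
  shows "\<exists>\<Phi>. continuous_on UNIV \<Phi> \<and> \<Phi> x = x \<and> \<Phi> ` V \<subseteq> V \<and> (\<forall>y a b. (a, b) \<in> G \<longrightarrow> a \<bullet> \<Phi> y = b)"
  using G x
proof (induction G)
  case empty
  show ?case by (intro exI[of _ id]) (auto intro: continuous_on_id)
next
  case (insert g G)
  have "\<exists>\<Phi>. continuous_on UNIV \<Phi> \<and> \<Phi> x = x \<and> \<Phi> ` V \<subseteq> V \<and> (\<forall>y a b. (a, b) \<in> G \<longrightarrow> a \<bullet> \<Phi> y = b)"
    by (rule insert.IH) (use insert.prems in auto)
  then obtain \<Phi> where \<Phi>: "continuous_on UNIV \<Phi>" "\<Phi> x = x" "\<And>y. y \<in> V \<Longrightarrow> \<Phi> y \<in> V"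
     "\<And>y a b. (a, b) \<in> G \<Longrightarrow> a \<bullet> \<Phi> y = b"
    by (auto simp: image_subset_iff)
  obtain a b where g: "g = (a, b)" by force
  have ab: "\<And>v. v \<in> V \<Longrightarrow> a \<bullet> v \<in> \<rat>" "b \<in> \<rat>" "a \<bullet> x = b" using insert.prems g by auto
  show ?case
  proof (cases "\<forall>y\<in>V. a \<bullet> \<Phi> y = b")
    case True
    have "a \<bullet> \<Phi> y = b" for y
    proof -
      have "closure V \<subseteq> {y. a \<bullet> \<Phi> y = b}"
        using True \<Phi>(1) by (intro closure_minimal closed_Collect_eq continuous_intros) auto
      then show ?thesis using V(1) by auto
    qed
    then show ?thesis using \<Phi> g by (intro exI[of _ \<Phi>]) auto
  next
    case False
    then obtain y0 where y0: "y0 \<in> V" "a \<bullet> \<Phi> y0 \<noteq> b" by auto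
    \<comment> \<open>If \<open>a \<bullet> \<Phi> y\<close> were constant on \<open>V\<close>,
      density would make it constant everywhere; but at the fixed point \<open>x\<close> it equals
      \<open>b\<close>, unlike at \<open>y0\<close>.\<close>
    have "\<exists>y1\<in>V. a \<bullet> \<Phi> y1 \<noteq> a \<bullet> \<Phi> y0"
    proof (rule ccontr)
      assume "\<not> ?thesis"
      then have "closure V \<subseteq> {y. a \<bullet> \<Phi> y = a \<bullet> \<Phi> y0}"
        using \<Phi>(1) by (intro closure_minimal closed_Collect_eq continuous_intros) auto
      then have "a \<bullet> \<Phi> x = a \<bullet> \<Phi> y0" using V(1) by blast
      then show False using \<Phi>(2) ab(3) y0(2) by simp
    qed
    then obtain y1 where y1: "y1 \<in> V" "a \<bullet> \<Phi> y1 \<noteq> a \<bullet> \<Phi> y0" by auto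
    define v where "v = \<Phi> y1 - \<Phi> y0"
    have v: "v \<in> V" "a \<bullet> v \<noteq> 0" "\<And>a b. (a, b) \<in> G \<Longrightarrow> a \<bullet> v = 0"
      using V(2) \<Phi>(3,4) y0 y1 by (auto simp: v_def inner_diff_right)
    \<comment> \<open>Projection along \<open>v\<close> onto the new hyperplane. For
      \<open>y\<close> in \<open>V\<close> the factor of \<open>v\<close> is a quotient of
      rationals, so \<open>V\<close> is preserved.\<close>
    define \<Psi> where "\<Psi> y = \<Phi> y - ((a \<bullet> \<Phi> y - b) / (a \<bullet> v)) *\<^sub>R v" for y
    have "continuous_on UNIV \<Psi>"
      unfolding \<Psi>_def using \<Phi>(1) v(2) by (intro continuous_intros) auto
    moreover have "\<Psi> x = x" using \<Phi>(2) ab(3) by (simp add: \<Psi>_def)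
    moreover have "\<Psi> y \<in> V" if "y \<in> V" for y
      unfolding \<Psi>_def using that ab v(1) \<Phi>(3) by (intro V Rats_divide Rats_diff) auto
    moreover have "a' \<bullet> \<Psi> y = b'" if "(a', b') \<in> insert g G" for a' b' y
      using that v \<Phi>(4) g by (auto simp: \<Psi>_def inner_diff_right)
    ultimately show ?thesis by (intro exI[of _ \<Psi>]) auto
  qed
qed

text \<open>Rational points converging to \<open>x\<close> may miss the hyperplanes through
  \<open>x\<close>. The retraction puts them back onto these without moving the limit, and nearness
  to \<open>x\<close> secures the signs at all other hyperplanes.\<close>

lemma open_cell_subset_closure_rational:
  fixes V :: "'a::euclidean_space set"
  assumes V: "closure V = UNIV" "\<And>u v. u \<in> V \<Longrightarrow> v \<in> V \<Longrightarrow> u - v \<in> V"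
      "\<And>q v. q \<in> \<rat> \<Longrightarrow> v \<in> V \<Longrightarrow> q *\<^sub>R v \<in> V"
    and G: "finite G" "\<And>a b. (a, b) \<in> G \<Longrightarrow> (\<forall>v\<in>V. a \<bullet> v \<in> \<rat>) \<and> b \<in> \<rat>"
  shows "x \<in> closure (open_cell G x \<inter> V)"
proof -
  define Z where "Z = {(a, b)\<in>G. a \<bullet> x = b}"
  have "finite Z" unfolding Z_def by (rule finite_subset[OF _ G(1)]) auto
  then have "\<exists>\<Phi>. continuous_on UNIV \<Phi> \<and> \<Phi> x = x \<and> \<Phi> ` V \<subseteq> V \<and>
      (\<forall>y a b. (a, b) \<in> Z \<longrightarrow> a \<bullet> \<Phi> y = b)"
    by (intro rational_retraction[OF V]) (use G(2) in \<open>simp_all add: Z_def\<close>)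
  then obtain \<Phi> where \<Phi>: "continuous_on UNIV \<Phi>" "\<Phi> x = x" "\<And>y. y \<in> V \<Longrightarrow> \<Phi> y \<in> V"
     "\<And>y a b. (a, b) \<in> Z \<Longrightarrow> a \<bullet> \<Phi> y = b"
    by (auto simp: image_subset_iff)
  obtain s where s: "\<And>n. s n \<in> V" "s \<longlonglongrightarrow> x"
    using V(1) closure_sequential[of x V] by auto
  have "isCont \<Phi> x" using \<Phi>(1) by (simp add: continuous_on_eq_continuous_at)
  then have lim: "(\<lambda>n. \<Phi> (s n)) \<longlonglongrightarrow> x" using isCont_tendsto_compose[OF _ s(2), of \<Phi>] \<Phi>(2) by simp
  have "\<forall>\<^sub>F n in sequentially. \<forall>(a, b)\<in>G. a \<bullet> x \<noteq> b \<longrightarrow> sgn (a \<bullet> \<Phi> (s n) - b) = sgn (a \<bullet> x - b)"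
    by (rule eventually_compose_filterlim[OF eventually_open_halfspaces[OF G(1)] lim])
  then have "\<forall>\<^sub>F n in sequentially. \<Phi> (s n) \<in> open_cell G x \<inter> V"
  proof (rule eventually_mono, intro IntI)
    fix n assume n: "\<forall>(a, b)\<in>G. a \<bullet> x \<noteq> b \<longrightarrow> sgn (a \<bullet> \<Phi> (s n) - b) = sgn (a \<bullet> x - b)"
    show "\<Phi> (s n) \<in> open_cell G x"
      unfolding open_cell_def
    proof clarify
      fix a b assume ab: "(a, b) \<in> G"
      show "sgn (a \<bullet> \<Phi> (s n) - b) = sgn (a \<bullet> x - b)"
        using bspec[OF n ab] ab \<Phi>(4)[of a b "s n"] by (cases "a \<bullet> x = b") (simp_all add: Z_def)
    qed
  qed (use \<Phi>(3) s(1) in auto)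
  then have "\<forall>\<^sub>F n in sequentially. \<Phi> (s n) \<in> closure (open_cell G x \<inter> V)"
    by (rule eventually_mono) (rule set_mp[OF closure_subset])
  then show ?thesis
    by (rule Lim_in_closed_set[OF closed_closure _ _ lim]) simp
qed

text \<open>The open segment from a point of the closed cell to \<open>x\<close> lies in the open
  cell: at each hyperplane the sign at \<open>x\<close> is combined with the same sign or with
  zero.\<close>

lemma closed_cell_subset_closure_open_cell: "closed_cell G x \<subseteq> closure (open_cell G x)"
proof
  fix y assume y: "y \<in> closed_cell G x"
  let ?w = "\<lambda>t. y + t *\<^sub>R (x - y)"
  have "?w t \<in> open_cell G x" if t: "0 < t" "t < 1" for t
    unfolding open_cell_def
  proof clarify
    fix a b assume ab: "(a, b) \<in> G"
    have eq: "a \<bullet> ?w t - b = (1 - t) * (a \<bullet> y - b) + t * (a \<bullet> x - b)"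
      by (simp add: inner_add_right inner_diff_right algebra_simps)
    have "a \<bullet> y = b \<or> sgn (a \<bullet> y - b) = sgn (a \<bullet> x - b)"
      using y ab unfolding closed_cell_alt by (fastforce dest: bspec)
    then show "sgn (a \<bullet> ?w t - b) = sgn (a \<bullet> x - b)"
    proof
      assume "a \<bullet> y = b"
      then show ?thesis using t by (simp add: eq sgn_mult)
    next
      assume *: "sgn (a \<bullet> y - b) = sgn (a \<bullet> x - b)"
      consider "a \<bullet> x = b" | "a \<bullet> x > b" | "a \<bullet> x < b" by linarith
      then show ?thesis
      proof cases
        case 1
        with * show ?thesis unfolding eq by (simp add: sgn_0_0)
      next
        case 2
        with * have "a \<bullet> y > b" by (auto simp: sgn_real_def split: if_splits)
        then have "(1 - t) * (a \<bullet> y - b) + t * (a \<bullet> x - b) > 0"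
          using 2 t by (intro add_pos_pos mult_pos_pos) auto
        then show ?thesis using 2 unfolding eq by simp
      next
        case 3
        with * have "a \<bullet> y < b" by (auto simp: sgn_real_def split: if_splits)
        then have "(1 - t) * (a \<bullet> y - b) + t * (a \<bullet> x - b) < 0"
          using 3 t by (intro add_neg_neg mult_pos_neg) auto
        then show ?thesis using 3 unfolding eq by simp
      qed
    qed
  qed
  then have ev: "\<forall>\<^sub>F t in at_right 0. ?w t \<in> open_cell G x"
    unfolding eventually_at_right_field by (intro exI[of _ 1]) simp
  have "(?w \<longlongrightarrow> ?w 0) (at_right 0)" by (intro tendsto_intros)
  then have lim: "(?w \<longlongrightarrow> y) (at_right 0)" by simp
  have "\<forall>\<^sub>F t in at_right 0. ?w t \<in> closure (open_cell G x)"
    using ev by (rule eventually_mono) (rule set_mp[OF closure_subset])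
  then show "y \<in> closure (open_cell G x)"
    by (rule Lim_in_closed_set[OF closed_closure _ trivial_limit_at_right_real lim])
qed

lemma closure_rational_points_eq_Union_cell_complex:
  fixes V :: "'a::euclidean_space set"
  assumes V: "closure V = UNIV" "\<And>u v. u \<in> V \<Longrightarrow> v \<in> V \<Longrightarrow> u - v \<in> V"
      "\<And>q v. q \<in> \<rat> \<Longrightarrow> v \<in> V \<Longrightarrow> q *\<^sub>R v \<in> V"
    and G: "finite G" "\<And>a b. (a, b) \<in> G \<Longrightarrow> (\<forall>v\<in>V. a \<bullet> v \<in> \<rat>) \<and> b \<in> \<rat>"
    and T: "\<And>x. x \<in> T \<Longrightarrow> open_cell G x \<subseteq> T"
  shows "closure (T \<inter> V) = \<Union>(cell_complex G T)"
proof
  have closed: "closed (closed_cell G x)" for x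
  proof -
    have "closed_cell G x = (\<Inter>(a, b)\<in>G. (if a \<bullet> x \<le> b then {y. a \<bullet> y \<le> b} else UNIV) \<inter>
       (if b \<le> a \<bullet> x then {y. a \<bullet> y \<ge> b} else UNIV))"
      by (auto simp: closed_cell_def split: if_splits)
    also have "closed \<dots>"
      by (intro closed_INT ballI) (auto intro!: closed_Int simp: closed_halfspace_le closed_halfspace_ge)
    finally show ?thesis .
  qed
  have "(\<Union>x\<in>T. closed_cell G x) = \<Union>(closed_cell G ` T)" by simp
  moreover have "closed (\<Union>(closed_cell G ` T))"
    by (rule closed_Union) (use closed in \<open>auto intro: finite_subset[OF _ finite_closed_cells[OF G(1)]]\<close>)
  ultimately show "closure (T \<inter> V) \<subseteq> \<Union>(cell_complex G T)"
    unfolding Union_cell_complex by (intro closure_minimal) auto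
  have "closed_cell G x \<subseteq> closure (T \<inter> V)" if "x \<in> T" for x
  proof -
    have "open_cell G x \<subseteq> closure (T \<inter> V)"
    proof
      fix y assume y: "y \<in> open_cell G x"
      then have "y \<in> T" using T that by auto
      \<comment> \<open>Density is used at \<open>y\<close> in its own open cell, which lies in
        \<open>T\<close> because \<open>y\<close> does.\<close>
      then have "closure (open_cell G y \<inter> V) \<subseteq> closure (T \<inter> V)"
        using T by (intro closure_mono) auto
      then show "y \<in> closure (T \<inter> V)" using open_cell_subset_closure_rational[OF V G] by blast
    qed
    then have "closure (open_cell G x) \<subseteq> closure (T \<inter> V)" by (rule closure_minimal) simp
    then show ?thesis using closed_cell_subset_closure_open_cell by blast
  qed
  then show "\<Union>(cell_complex G T) \<subseteq> closure (T \<inter> V)" unfolding Union_cell_complex by blast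
qed

text \<open>A point of \<open>A\<close> lying on as few of the hyperplanes as possible has a neighbourhood in \<open>A\<close> which
  is contained in its cell.\<close>

lemma aff_dim_le_closed_cell:
  fixes A :: "'a::euclidean_space set"
  assumes G: "finite G" and A: "affine A" "open W" "A \<inter> W \<noteq> {}"
  obtains x where "x \<in> A \<inter> W" "aff_dim A \<le> aff_dim (closed_cell G x)"
proof -
  define Z where "Z x = {(a, b)\<in>G. a \<bullet> x = b}" for x
  have finZ: "finite (Z x)" for x unfolding Z_def by (rule finite_subset[OF _ G]) auto
  obtain x where x: "x \<in> A \<inter> W" "\<And>y. y \<in> A \<inter> W \<Longrightarrow> card (Z x) \<le> card (Z y)"
    using A(3) ex_has_least_nat[of "\<lambda>x. x \<in> A \<inter> W" _ "\<lambda>x. card (Z x)"] by blast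
  have "\<forall>\<^sub>F y in nhds x. y \<in> W" using x(1) A(2) eventually_nhds by blast
  then have "\<forall>\<^sub>F y in nhds x. y \<in> W \<and> (\<forall>(a, b)\<in>G. a \<bullet> x \<noteq> b \<longrightarrow> sgn (a \<bullet> y - b) = sgn (a \<bullet> x - b))"
    using eventually_open_halfspaces[OF G] by (rule eventually_conj)
  then obtain O' where O': "open O'" "x \<in> O'" and
    *: "\<forall>y\<in>O'. y \<in> W \<and> (\<forall>(a, b)\<in>G. a \<bullet> x \<noteq> b \<longrightarrow> sgn (a \<bullet> y - b) = sgn (a \<bullet> x - b))"
    unfolding eventually_nhds by (elim exE conjE)
  have O'_W: "y \<in> W" and O'_sgn: "(a, b) \<in> G \<Longrightarrow> a \<bullet> x \<noteq> b \<Longrightarrow> sgn (a \<bullet> y - b) = sgn (a \<bullet> x - b)"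
    if "y \<in> O'" for y a b
    using bspec[OF * that] by auto
  have "A \<inter> O' \<subseteq> closed_cell G x"
  proof
    fix y assume y: "y \<in> A \<inter> O'"
    have *: "a \<bullet> x = b \<or> sgn (a \<bullet> y - b) = sgn (a \<bullet> x - b)" if "(a, b) \<in> G" for a b
      using O'_sgn[of y a b] y that by auto
    \<comment> \<open>A hyperplane missing \<open>x\<close> also misses the nearby \<open>y\<close>;
      minimality of \<open>card (Z x)\<close> then forces \<open>y\<close> onto all hyperplanes
      through \<open>x\<close>.\<close>
    have "Z y \<subseteq> Z x" using * by (fastforce simp: Z_def sgn_0_0)
    moreover have "card (Z x) \<le> card (Z y)" using x(2) O'_W y by blast
    ultimately have Z: "Z y = Z x" using finZ by (meson card_seteq)
    have "a \<bullet> y = b \<or> sgn (a \<bullet> y - b) = sgn (a \<bullet> x - b)" if "(a, b) \<in> G" for a b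
    proof (cases "a \<bullet> x = b")
      case True
      then have "(a, b) \<in> Z x" using that by (simp add: Z_def)
      then have "(a, b) \<in> Z y" by (simp only: Z)
      then show ?thesis by (simp add: Z_def)
    qed (use * that in auto)
    then show "y \<in> closed_cell G x" unfolding closed_cell_alt by (intro CollectI ballI) (simp add: case_prod_unfold)
  qed
  then have "aff_dim (A \<inter> O') \<le> aff_dim (closed_cell G x)" by (rule aff_dim_subset)
  moreover have "aff_dim (A \<inter> O') = aff_dim A"
    using A(1) O'(1,2) x(1) by (intro aff_dim_convex_Int_open) (auto simp: affine_imp_convex)
  ultimately show thesis using that x(1) by metis
qed

section \<open>The lexicographic order\<close>

lemma lex_nonneg_0 [simp]: "lex_nonneg 0"
  by (simp add: lex_nonneg_def)

lemma lex_nonneg_total: "lex_nonneg x \<or> lex_nonneg (- x)"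
proof (cases "x = 0")
  case False
  define S where "S = {i. x $ i \<noteq> 0}"
  have S: "finite S" "S \<noteq> {}" using False by (auto simp: S_def vec_eq_iff)
  define i where "i = Max S"
  have "x $ i \<noteq> 0" using Max_in[OF S] by (simp add: i_def S_def)
  moreover have "x $ j = 0" if "j > i" for j
  proof (rule ccontr)
    assume "x $ j \<noteq> 0"
    then have "j \<le> i" unfolding i_def by (intro Max_ge S(1)) (simp add: S_def)
    then show False using that by simp
  qed
  ultimately have "(x $ i > 0 \<and> (\<forall>j>i. x $ j = 0)) \<or> ((- x) $ i > 0 \<and> (\<forall>j>i. (- x) $ j = 0))"
    by (simp add: neq_iff disj_commute)
  then show ?thesis unfolding lex_nonneg_def by blast
qed simp

lemma lex_nonneg_antisym:
  assumes "lex_nonneg x" "lex_nonneg (- x)"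
  shows "x = 0"
proof (rule ccontr)
  assume "x \<noteq> 0"
  then obtain i j where "x $ i > 0" "\<forall>k>i. x $ k = 0" "(- x) $ j > 0" "\<forall>k>j. (- x) $ k = 0"
    using assms by (auto simp: lex_nonneg_def)
  then show False by (cases i j rule: linorder_cases) auto
qed

lemma lex_nonneg_add:
  assumes "lex_nonneg x" "lex_nonneg y"
  shows "lex_nonneg (x + y)"
proof (cases "x = 0 \<or> y = 0")
  case False
  then obtain i j where ij: "x $ i > 0" "\<forall>k>i. x $ k = 0" "y $ j > 0" "\<forall>k>j. y $ k = 0"
    using assms by (auto simp: lex_nonneg_def)
  have "(x + y) $ max i j > 0 \<and> (\<forall>k>max i j. (x + y) $ k = 0)"
    using ij by (cases i j rule: linorder_cases) (auto simp: max_def)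
  then show ?thesis unfolding lex_nonneg_def by blast
qed (use assms in auto)

lemma lex_nonneg_scaleR: "r > 0 \<Longrightarrow> lex_nonneg x \<Longrightarrow> lex_nonneg (r *\<^sub>R x)"
  unfolding lex_nonneg_def by (auto simp: zero_less_mult_iff)

text \<open>This is what lets an arrangement that compares coordinates one by one decide
  lexicographic inequalities.\<close>

lemma lex_nonneg_sgn_cong:
  fixes x y :: "real ^ 'n::{finite,linorder}"
  assumes "\<And>i. sgn (x $ i) = sgn (y $ i)"
  shows "lex_nonneg x \<longleftrightarrow> lex_nonneg y"
proof -
  have "x $ i > 0 \<longleftrightarrow> y $ i > 0" "x $ i = 0 \<longleftrightarrow> y $ i = 0" for i
    using assms[of i] by (simp_all add: sgn_real_def split: if_splits)
  then show ?thesis by (simp add: lex_nonneg_def vec_eq_iff)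
qed

lemma lex_nonneg_top:
  fixes x :: "real ^ 'n::{finite,linorder}"
  assumes "x $ Max UNIV > 0"
  shows "lex_nonneg x"
  unfolding lex_nonneg_def
  by (rule disjI2, rule exI[of _ "Max UNIV"]) (use assms in \<open>auto simp: not_less[symmetric]\<close>)

text \<open>A copy of \<open>real ^ 'n\<close> carrying the lexicographic order, since the type itself is ordered
  componentwise.\<close>

typedef (overloaded) 'n lexvec = "UNIV :: (real ^ 'n::{finite,linorder}) set"
  morphisms vec_of_lex lex_of_vec
  by simp

instantiation lexvec :: ("{finite,linorder}") linordered_ab_group_add
begin

definition "0 = lex_of_vec 0"
definition "a + b = lex_of_vec (vec_of_lex a + vec_of_lex b)"
definition "- a = lex_of_vec (- vec_of_lex a)"
definition "a - b = lex_of_vec (vec_of_lex a - vec_of_lex b)"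
definition "a \<le> b \<longleftrightarrow> lex_nonneg (vec_of_lex b - vec_of_lex a)"
definition "(a::'a lexvec) < b \<longleftrightarrow> a \<le> b \<and> \<not> b \<le> a"

instance
proof
  fix a b c :: "'a lexvec"
  note defs = zero_lexvec_def plus_lexvec_def uminus_lexvec_def minus_lexvec_def less_eq_lexvec_def
    less_lexvec_def lex_of_vec_inverse[simplified] vec_of_lex_inverse
  show "a + b + c = a + (b + c)" "a + b = b + a" "0 + a = a" "- a + a = 0" "a - b = a + - b"
    by (simp_all add: defs algebra_simps)
  show "a < b \<longleftrightarrow> a \<le> b \<and> \<not> b \<le> a" "a \<le> a"
    by (simp_all add: defs)
  show "a \<le> c" if "a \<le> b" "b \<le> c"
    using lex_nonneg_add[of "vec_of_lex b - vec_of_lex a" "vec_of_lex c - vec_of_lex b"] that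
    by (simp add: defs)
  show "a = b" if "a \<le> b" "b \<le> a"
    using lex_nonneg_antisym[of "vec_of_lex b - vec_of_lex a"] that
    by (simp add: defs vec_of_lex_inject)
  show "a \<le> b \<or> b \<le> a"
    using lex_nonneg_total[of "vec_of_lex b - vec_of_lex a"] by (simp add: defs)
  show "c + a \<le> c + b" if "a \<le> b"
    using that by (simp add: defs)
qed

end

lemma lex_of_vec_simps:
  "lex_of_vec (x + y) = lex_of_vec x + lex_of_vec y"
  "lex_of_vec x \<le> lex_of_vec y \<longleftrightarrow> lex_nonneg (y - x)"
  "lex_of_vec x = lex_of_vec y \<longleftrightarrow> x = y"
  "lex_of_vec x = 0 \<longleftrightarrow> x = 0"
  by (simp_all add: plus_lexvec_def less_eq_lexvec_def zero_lexvec_def lex_of_vec_inverse lex_of_vec_inject)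

section \<open>Tropical hypersurfaces\<close>

text \<open>Supplies generic directions. If the direction found so far kills the new vector
  \<open>x\<close>, scale it up and add \<open>x\<close>, which pairs positively with
  itself.\<close>

lemma exists_integer_functional_nonzero:
  fixes B :: "(int ^ 'm::finite) set"
  assumes "finite B" "0 \<notin> B"
  shows "\<exists>d :: int ^ 'm. \<forall>x\<in>B. (\<Sum>j\<in>UNIV. x $ j * d $ j) \<noteq> 0"
  using assms
proof (induction B)
  case (insert x B)
  define s where "s y d = (\<Sum>j\<in>UNIV. y $ j * d $ j)" for y d :: "int ^ 'm"
  obtain d where d: "\<And>y. y \<in> B \<Longrightarrow> s y d \<noteq> 0" using insert by (auto simp: s_def)
  \<comment> \<open>Larger than every \<open>\<bar>s y x\<bar>\<close>. A nonzero integer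
    \<open>s y d\<close> has absolute value at least one, so \<open>s y x\<close> cannot cancel
    \<open>k * s y d\<close>.\<close>
  define k where "k = 1 + (\<Sum>y\<in>B. \<bar>s y x\<bar>)"
  define d' where "d' = (\<chi> j. k * d $ j + x $ j)"
  have sd': "s y d' = k * s y d + s y x" for y
    by (simp add: s_def d'_def sum.distrib sum_distrib_left algebra_simps)
  have k1: "k \<ge> 1" by (simp add: k_def sum_nonneg)
  have nz: "s y d' \<noteq> 0" if y: "y \<in> B" for y
  proof -
    have "\<bar>s y x\<bar> < k" using member_le_sum[OF y, of "\<lambda>y. \<bar>s y x\<bar>"] insert.hyps by (simp add: k_def)
    moreover have "k * 1 \<le> k * \<bar>s y d\<bar>" using k1 d[OF y] by (intro mult_left_mono) auto
    moreover have "k * \<bar>s y d\<bar> = \<bar>k * s y d\<bar>" using k1 by (simp add: abs_mult)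
    ultimately have "\<bar>s y x\<bar> < \<bar>k * s y d\<bar>" by linarith
    then show ?thesis unfolding sd' by linarith
  qed
  show ?case
  proof (cases "s x d = 0")
    case True
    obtain j where "x $ j \<noteq> 0" using insert.prems by (auto simp: vec_eq_iff)
    then have "x $ j * x $ j > 0" by (auto simp: zero_less_mult_iff)
    then have "s x x > 0" unfolding s_def by (intro sum_pos2[of _ j]) auto
    then have "s x d' \<noteq> 0" using True by (simp add: sd')
    then show ?thesis using nz by (intro exI[of _ d']) (auto simp: s_def)
  next
    case False
    then show ?thesis using d by (intro exI[of _ d]) (auto simp: s_def)
  qed
qed simp

text \<open>This selects an edge of the Newton polytope: \<open>u\<^sub>0\<close> is the vertex minimizing a generic functional
  \<open>d\<^sub>1\<close>, and the edge at \<open>u\<^sub>0\<close> is the one of minimal slope of a second generic functional \<open>d\<^sub>2\<close>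
  against \<open>d\<^sub>1\<close>.\<close>

lemma exists_edge:
  fixes U :: "(int ^ 'm::finite) set"
  assumes U: "finite U" "card U \<ge> 2"
  obtains u0 u1 and D :: "int ^ 'm" where
    "u0 \<in> U" "u1 \<in> U" "u0 \<noteq> u1" "(\<Sum>j\<in>UNIV. (u1 - u0) $ j * D $ j) = 0"
    "\<forall>w\<in>U. (\<Sum>j\<in>UNIV. (w - u0) $ j * D $ j) \<ge> 0"
    "\<forall>w\<in>U. w \<noteq> u0 \<longrightarrow> (\<Sum>j\<in>UNIV. (w - u0) $ j * D $ j) = 0 \<longrightarrow>
       (\<exists>r>0. \<forall>j. real_of_int ((w - u0) $ j) = r * real_of_int ((u1 - u0) $ j))"
proof -
  define s where "s x d = (\<Sum>j\<in>UNIV. x $ j * d $ j)" for x d :: "int ^ 'm"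
  have s_diff: "s (x - y) d = s x d - s y d" for x y d
    by (simp add: s_def sum_subtractf left_diff_distrib)
  have s_lin: "s x (\<chi> j. a * d $ j - b * d' $ j) = a * s x d - b * s x d'"
    "s (\<chi> j. a * x $ j - b * y $ j) d = a * s x d - b * s y d" for x y d d' a b
    by (simp_all add: s_def left_diff_distrib right_diff_distrib sum_subtractf sum_distrib_left mult_ac)
  obtain d1 where "\<forall>x\<in>(\<lambda>(u, w). u - w) ` (U \<times> U) - {0}. s x d1 \<noteq> 0"
    using exists_integer_functional_nonzero[of "(\<lambda>(u, w). u - w) ` (U \<times> U) - {0}"] U(1)
    by (auto simp: s_def)
  then have d1: "s u d1 \<noteq> s w d1" if "u \<in> U" "w \<in> U" "u \<noteq> w" for u w
    using that s_diff[of u w d1] by force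
  have "U \<noteq> {}" using U(2) by auto
  then obtain u0 where u0: "u0 \<in> U" "\<And>w. w \<in> U \<Longrightarrow> s u0 d1 \<le> s w d1"
    using ex_is_arg_min_if_finite[of U "\<lambda>w. s w d1"] U(1) by (auto simp: is_arg_min_linorder)
  define l where "l w = s (w - u0) d1" for w
  have l_pos: "l w > 0" if "w \<in> U" "w \<noteq> u0" for w
    using u0(2)[OF that(1)] d1[OF that(1) u0(1) that(2)] by (simp add: l_def s_diff)
  \<comment> \<open>For exponents other than \<open>u0\<close>, this vector vanishes exactly when
    \<open>u - u0\<close> and \<open>w - u0\<close> are parallel, and its pairing with
    \<open>d2\<close> vanishes exactly when the slopes \<open>h / l\<close> agree. Genericity of
    \<open>d2\<close> thus makes equal slopes parallel.\<close>
  define x where "x u w = (\<chi> j. l u * (w - u0) $ j - l w * (u - u0) $ j)" for u w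
  obtain d2 where "\<forall>y\<in>(\<lambda>(u, w). x u w) ` (U \<times> U) - {0}. s y d2 \<noteq> 0"
    using exists_integer_functional_nonzero[of "(\<lambda>(u, w). x u w) ` (U \<times> U) - {0}"] U(1)
    by (auto simp: s_def)
  then have d2: "x u w = 0" if "u \<in> U" "w \<in> U" "s (x u w) d2 = 0" for u w
    using that by force
  define h where "h w = s (w - u0) d2" for w
  have "U - {u0} \<noteq> {}"
  proof
    assume "U - {u0} = {}"
    then have "card U \<le> card {u0}" by (intro card_mono) auto
    then show False using U(2) by simp
  qed
  then obtain u1 where u1: "u1 \<in> U" "u1 \<noteq> u0"
      "\<And>w. w \<in> U - {u0} \<Longrightarrow> real_of_int (h u1) / real_of_int (l u1) \<le> real_of_int (h w) / real_of_int (l w)"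
    using ex_is_arg_min_if_finite[of "U - {u0}" "\<lambda>w. real_of_int (h w) / real_of_int (l w)"] U(1)
    by (auto simp: is_arg_min_linorder)
  \<comment> \<open>\<open>d2\<close> minus the minimal slope times \<open>d1\<close>, multiplied by
    \<open>l u1\<close> to stay integral. It vanishes on \<open>u1 - u0\<close>, and minimality of
    the slope makes it nonnegative on all \<open>w - u0\<close>.\<close>
  define D where "D = (\<chi> j. l u1 * d2 $ j - h u1 * d1 $ j)"
  have sD: "s (w - u0) D = l u1 * h w - h u1 * l w" for w
    unfolding D_def s_lin h_def l_def ..
  have sx: "s (x u1 w) d2 = s (w - u0) D" for w
    unfolding sD x_def s_lin h_def by simp
  have sD_nonneg: "s (w - u0) D \<ge> 0" if "w \<in> U" for w
  proof (cases "w = u0")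
    case False
    have "real_of_int (h u1) * real_of_int (l w) \<le> real_of_int (h w) * real_of_int (l u1)"
      using u1(3)[of w] that False l_pos[OF u1(1,2)] l_pos[OF that False] by (simp add: divide_simps mult.commute)
    then have "h u1 * l w \<le> h w * l u1" by (simp only: of_int_mult[symmetric] of_int_le_iff)
    then show ?thesis by (simp add: sD mult.commute)
  qed (simp add: sD l_def h_def s_def)
  have edge: "\<exists>r>0. \<forall>j. real_of_int ((w - u0) $ j) = r * real_of_int ((u1 - u0) $ j)"
    if w: "w \<in> U" "w \<noteq> u0" "s (w - u0) D = 0" for w
  proof (intro exI[of _ "real_of_int (l w) / real_of_int (l u1)"] conjI allI)
    show "real_of_int (l w) / real_of_int (l u1) > 0" using l_pos w u1 by simp
    fix j
    have "x u1 w = 0" using d2 w u1(1) sx by simp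
    then have "l u1 * (w - u0) $ j = l w * (u1 - u0) $ j" by (simp add: x_def vec_eq_iff)
    then have "real_of_int (l u1) * real_of_int ((w - u0) $ j) = real_of_int (l w) * real_of_int ((u1 - u0) $ j)"
      by (simp only: of_int_mult[symmetric])
    then show "real_of_int ((w - u0) $ j) = real_of_int (l w) / real_of_int (l u1) * real_of_int ((u1 - u0) $ j)"
      using l_pos[OF u1(1,2)] by (simp add: field_simps)
  qed
  have "s (u1 - u0) D = 0" by (simp add: sD)
  then show thesis
    using sD_nonneg edge u0(1) u1(1,2) unfolding s_def by (intro that[of u0 u1 D]) simp_all
qed

section \<open>Level sets of a linear combination of the rows of a matrix\<close>

lemma inner_axis_matrix:
  fixes p :: "real ^ 'n ^ 'm"
  shows "(\<chi> j. axis i (r j)) \<bullet> p = (\<Sum>j\<in>UNIV. r j * p $ j $ i)"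
  by (simp add: inner_vec_def[of _ p] inner_axis')

lemma affine_combination_level_set: "affine {p :: real ^ 'n ^ 'm. (\<Sum>j\<in>UNIV. e $ j *\<^sub>R p $ j) = q}"
proof -
  have eq: "{p :: real ^ 'n ^ 'm. (\<Sum>j\<in>UNIV. e $ j *\<^sub>R p $ j) = q} =
     (\<Inter>i. {p. (\<chi> j. axis i (e $ j)) \<bullet> p = q $ i})"
    by (auto simp: inner_axis_matrix vec_eq_iff)
  show ?thesis unfolding eq by (intro affine_Inter ballI) (auto simp: affine_hyperplane)
qed

lemma combination_level_set_nonempty:
  assumes "e \<noteq> 0"
  obtains p :: "real ^ 'n ^ 'm" where "(\<Sum>j\<in>UNIV. e $ j *\<^sub>R p $ j) = q"
proof -
  obtain k where k: "e $ k \<noteq> 0" using assms by (auto simp: vec_eq_iff)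
  have "(\<Sum>j\<in>UNIV. e $ j *\<^sub>R (\<chi> j. if j = k then (1 / e $ k) *\<^sub>R q else 0) $ j) =
     (\<Sum>j\<in>UNIV. if j = k then q else 0)"
    by (intro sum.cong) (use k in auto)
  also have "\<dots> = q" by simp
  finally show thesis by (rule that)
qed

text \<open>The vector equation splits into one scalar equation per column, with normal
  \<open>w i\<close>, the matrix having \<open>e\<close> as column \<open>i\<close> and zeros
  elsewhere. These normals have disjoint supports, so they are orthogonal and the codimension is
  their number.\<close>

lemma aff_dim_combination_level_set:
  fixes q :: "real ^ 'n"
  assumes e: "e \<noteq> 0"
  shows "aff_dim {p :: real ^ 'n ^ 'm. (\<Sum>j\<in>UNIV. e $ j *\<^sub>R p $ j) = q} =
    int CARD('m) * int CARD('n) - int CARD('n)" (is "aff_dim ?A = _")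
proof -
  define w :: "'n \<Rightarrow> real ^ 'n ^ 'm" where "w i = (\<chi> j. axis i (e $ j))" for i
  have w_inner: "w i \<bullet> p = (\<Sum>j\<in>UNIV. e $ j * p $ j $ i)" for i p
    by (simp add: w_def inner_axis_matrix)
  have w_nz: "w i \<noteq> 0" for i
  proof -
    obtain k where "e $ k \<noteq> 0" using e by (auto simp: vec_eq_iff)
    then have "w i $ k $ i \<noteq> 0" by (simp add: w_def)
    then show ?thesis by force
  qed
  have w_orth: "w i \<bullet> w k = 0" if "i \<noteq> k" for i k
    using that unfolding w_inner by (simp add: w_def axis_def)
  have inj: "inj w" using w_orth w_nz by (metis injI inner_eq_zero_iff)
  have "pairwise orthogonal (range w)"
    by (auto simp: pairwise_def orthogonal_def intro: w_orth)
  then have "independent (range w)"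
    using w_nz by (intro pairwise_orthogonal_independent) (auto simp: image_iff)
  then have dim_w: "dim (span (range w)) = CARD('n)"
    using inj by (simp add: dim_eq_card_independent card_image)
  obtain p0 where p0: "p0 \<in> ?A" using combination_level_set_nonempty[OF e, of q] by blast
  have K: "(\<lambda>x. x - p0) ` ?A = {y \<in> UNIV. \<forall>x\<in>span (range w). orthogonal x y}" (is "?L = ?R")
  proof -
    have iff: "y \<in> ?L \<longleftrightarrow> y + p0 \<in> ?A" for y
    proof
      assume "y + p0 \<in> ?A"
      then have "(y + p0) - p0 \<in> ?L" by (rule imageI)
      then show "y \<in> ?L" by simp
    qed auto
    have iff2: "y + p0 \<in> ?A \<longleftrightarrow> (\<forall>i. w i \<bullet> y = 0)" for y
      using p0 by (simp add: w_inner vec_eq_iff sum.distrib distrib_left)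
    have iff3: "(\<forall>i. w i \<bullet> y = 0) \<longleftrightarrow> y \<in> ?R" for y
    proof
      assume "\<forall>i. w i \<bullet> y = 0"
      then have "range w \<subseteq> {x. x \<bullet> y = 0}" by auto
      moreover have "subspace {x. x \<bullet> y = 0}" by (auto simp: subspace_def inner_add_left)
      ultimately have "span (range w) \<subseteq> {x. x \<bullet> y = 0}" by (rule span_minimal)
      then show "y \<in> ?R" by (auto simp: orthogonal_def)
    next
      assume "y \<in> ?R"
      then show "\<forall>i. w i \<bullet> y = 0" by (auto simp: orthogonal_def span_base)
    qed
    show ?thesis by (rule Set.set_eqI) (simp only: iff iff2 iff3)
  qed
  have "dim ?R + dim (span (range w)) = dim (UNIV :: (real ^ 'n ^ 'm) set)"
    by (rule dim_subspace_orthogonal_to_vectors) auto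
  then have "int (dim ?R) = int CARD('m) * int CARD('n) - int CARD('n)"
    using dim_w by (simp flip: of_nat_mult)
  then show ?thesis
    using aff_dim_dim_affine_diffs[OF affine_combination_level_set p0] unfolding K by simp
qed

text \<open>If \<open>c u\<close> is the valuation of a coefficient, this is the valuation of its
  monomial at every point whose coordinates have the valuations \<open>p\<close>.\<close>

definition trop_term ::
  "(int ^ 'm::finite \<Rightarrow> real ^ 'n) \<Rightarrow> int ^ 'm \<Rightarrow> real ^ 'n ^ 'm \<Rightarrow> real ^ 'n" where
  "trop_term c u p = c u + (\<Sum>j\<in>UNIV. real_of_int (u $ j) *\<^sub>R p $ j)"

definition tropical_locus ::
  "(int ^ 'm::finite) set \<Rightarrow> (int ^ 'm \<Rightarrow> real ^ 'n::{finite,linorder}) \<Rightarrow> (real ^ 'n::{finite,linorder} ^ 'm) set" where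
  "tropical_locus U c = {p. \<exists>u\<in>U. \<exists>v\<in>U. u \<noteq> v \<and> trop_term c u p = trop_term c v p \<and>
     (\<forall>w\<in>U. lex_nonneg (trop_term c w p - trop_term c u p))}"

text \<open>Only distinct exponents are compared, so that every normal is nonzero, as rational
  polyhedra demand.\<close>

definition comparison_hyperplanes ::
  "(int ^ 'm::finite) set \<Rightarrow> (int ^ 'm \<Rightarrow> real ^ 'n) \<Rightarrow> ((real ^ 'n ^ 'm) \<times> real) set" where
  "comparison_hyperplanes U c =
     (\<lambda>(u, v, i). (\<chi> j. axis i (real_of_int (u $ j - v $ j)), (c v - c u) $ i)) `
       {(u, v, i). u \<in> U \<and> v \<in> U \<and> u \<noteq> v}"

section \<open>The tropical locus as a union of cells, and its dimension\<close>

lemma trop_term_diff: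
  "trop_term c u p - trop_term c v p =
     (\<Sum>j\<in>UNIV. real_of_int (u $ j - v $ j) *\<^sub>R p $ j) - (c v - c u)"
  by (simp add: trop_term_def sum_subtractf scaleR_diff_left)

lemma trop_term_diff_component:
  fixes p :: "real ^ 'n ^ 'm::finite"
  shows "(trop_term c u p - trop_term c v p) $ i =
     (\<chi> j. axis i (real_of_int (u $ j - v $ j))) \<bullet> p - (c v - c u) $ i"
  unfolding trop_term_diff by (simp add: inner_axis_matrix)

lemma finite_comparison_hyperplanes: "finite U \<Longrightarrow> finite (comparison_hyperplanes U c)"
  unfolding comparison_hyperplanes_def
  by (rule finite_imageI, rule finite_subset[of _ "U \<times> U \<times> UNIV"]) auto

lemma comparison_hyperplanes_rational:
  assumes c: "\<And>u i. u \<in> U \<Longrightarrow> c u $ i \<in> \<rat>" and ab: "(a, b) \<in> comparison_hyperplanes U c"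
  shows "a \<noteq> 0 \<and> (\<forall>v\<in>{p. \<forall>j i. p $ j $ i \<in> \<rat>}. a \<bullet> v \<in> \<rat>) \<and> b \<in> \<rat>"
proof -
  obtain u v i where uv: "u \<in> U" "v \<in> U" "u \<noteq> v" "b = (c v - c u) $ i"
    "a = (\<chi> j. axis i (real_of_int (u $ j - v $ j)))"
    using ab by (auto simp: comparison_hyperplanes_def)
  obtain j where "u $ j \<noteq> v $ j" using uv(3) by (auto simp: vec_eq_iff)
  then have "a $ j $ i \<noteq> 0" by (simp add: uv(5))
  then have "a \<noteq> 0" by force
  moreover have "a \<bullet> p \<in> \<rat>" if "\<And>j i. p $ j $ i \<in> \<rat>" for p
    unfolding uv(5) inner_axis_matrix by (intro Rats_sum Rats_mult Rats_of_int that)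
  moreover have "b \<in> \<rat>" using uv c by simp
  ultimately show ?thesis by blast
qed

text \<open>Membership in the locus is decided by the signs of all coordinates of differences of two
  terms, and these are constant on an open cell.\<close>

lemma open_cell_subset_tropical_locus:
  assumes p: "p \<in> tropical_locus U c"
  shows "open_cell (comparison_hyperplanes U c) p \<subseteq> tropical_locus U c"
proof
  fix q assume q: "q \<in> open_cell (comparison_hyperplanes U c) p"
  have sgn: "sgn ((trop_term c u q - trop_term c v q) $ i) = sgn ((trop_term c u p - trop_term c v p) $ i)"
    if "u \<in> U" "v \<in> U" for u v i
  proof (cases "u = v")
    case False
    have "(\<chi> j. axis i (real_of_int (u $ j - v $ j)), (c v - c u) $ i) \<in> comparison_hyperplanes U c"
      unfolding comparison_hyperplanes_def by (rule image_eqI[of _ _ "(u, v, i)"]) (use that False in auto)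
    then show ?thesis using bspec[OF q[unfolded open_cell_def mem_Collect_eq]]
      unfolding trop_term_diff_component by blast
  qed simp
  obtain u v where uv: "u \<in> U" "v \<in> U" "u \<noteq> v" "trop_term c u p = trop_term c v p"
    "\<And>w. w \<in> U \<Longrightarrow> lex_nonneg (trop_term c w p - trop_term c u p)"
    using p by (auto simp: tropical_locus_def)
  have "(trop_term c u q - trop_term c v q) $ i = 0" for i
    using sgn[OF uv(1,2), of i] uv(4) by (simp add: sgn_0_0)
  then have "trop_term c u q = trop_term c v q" by (simp add: vec_eq_iff)
  moreover have "lex_nonneg (trop_term c w q - trop_term c u q)" if "w \<in> U" for w
    using lex_nonneg_sgn_cong[OF sgn[OF that uv(1)]] uv(5)[OF that] by simp
  ultimately show "q \<in> tropical_locus U c"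
    using uv unfolding tropical_locus_def by blast
qed

text \<open>A tie at the base point puts it on the hyperplanes of the tied pair for all coordinates.
  There both weak inequalities are imposed on the closed cell, so the tie persists throughout
  it.\<close>

lemma aff_dim_closed_cell_tropical_locus:
  fixes c :: "int ^ 'm::finite \<Rightarrow> real ^ 'n::{finite,linorder}"
  assumes p: "p \<in> tropical_locus U c"
  shows "aff_dim (closed_cell (comparison_hyperplanes U c) p) \<le> int CARD('m) * int CARD('n) - int CARD('n)"
proof -
  obtain u v where uv: "u \<in> U" "v \<in> U" "u \<noteq> v" "trop_term c u p = trop_term c v p"
    using p by (auto simp: tropical_locus_def)
  define e :: "real ^ 'm" where "e = (\<chi> j. real_of_int (u $ j - v $ j))"
  have "e \<noteq> 0" using uv(3) by (auto simp: e_def vec_eq_iff)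
  have "closed_cell (comparison_hyperplanes U c) p \<subseteq> {q. (\<Sum>j\<in>UNIV. e $ j *\<^sub>R q $ j) = c v - c u}"
  proof
    fix q assume q: "q \<in> closed_cell (comparison_hyperplanes U c) p"
    have "(trop_term c u q - trop_term c v q) $ i = 0" for i
    proof -
      have "(\<chi> j. axis i (real_of_int (u $ j - v $ j)), (c v - c u) $ i) \<in> comparison_hyperplanes U c"
        unfolding comparison_hyperplanes_def by (rule image_eqI[of _ _ "(u, v, i)"]) (use uv in auto)
      note cell = bspec[OF q[unfolded closed_cell_def mem_Collect_eq] this, unfolded case_prod_conv]
      have "(\<chi> j. axis i (real_of_int (u $ j - v $ j))) \<bullet> p = (c v - c u) $ i"
        using trop_term_diff_component[of c u p v i] uv(4) by simp
      then have "(\<chi> j. axis i (real_of_int (u $ j - v $ j))) \<bullet> q \<le> (c v - c u) $ i \<and>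
          (c v - c u) $ i \<le> (\<chi> j. axis i (real_of_int (u $ j - v $ j))) \<bullet> q"
        using cell by (simp only: order_refl simp_thms)
      then have "(\<chi> j. axis i (real_of_int (u $ j - v $ j))) \<bullet> q = (c v - c u) $ i" by simp
      then show ?thesis unfolding trop_term_diff_component by simp
    qed
    then have "trop_term c u q - trop_term c v q = 0" unfolding vec_eq_iff by simp
    then show "q \<in> {q. (\<Sum>j\<in>UNIV. e $ j *\<^sub>R q $ j) = c v - c u}"
      unfolding trop_term_diff e_def by simp
  qed
  from aff_dim_subset[OF this] show ?thesis
    unfolding aff_dim_combination_level_set[OF \<open>e \<noteq> 0\<close>] .
qed

lemma exists_lex_max:
  fixes g :: "'u \<Rightarrow> real ^ 'n::{finite,linorder}"
  assumes "finite E" "E \<noteq> {}"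
  obtains w where "w \<in> E" "\<And>w'. w' \<in> E \<Longrightarrow> lex_nonneg (g w - g w')"
proof -
  define M where "M = Max ((\<lambda>w. lex_of_vec (g w)) ` E)"
  have "M \<in> (\<lambda>w. lex_of_vec (g w)) ` E" unfolding M_def using assms by (intro Max_in) auto
  then obtain w where w: "w \<in> E" "M = lex_of_vec (g w)" by auto
  have "lex_of_vec (g w') \<le> lex_of_vec (g w)" if "w' \<in> E" for w'
    using assms that unfolding w(2)[symmetric] M_def by (intro Max_ge) auto
  then show thesis using that w(1) by (simp add: lex_of_vec_simps)
qed

text \<open>On an edge of the Newton polytope with direction \<open>e\<close>, all monomials depend on \<open>p\<close> only through
  its pairing with \<open>e\<close>, and fixing this pairing to be the lexicographically largest slope \<open>q\<close> makes the
  minimum occur twice.  Moving far in the direction \<open>D\<close>, in the most significant coordinate, makes the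
  monomials off the edge irrelevant.\<close>

lemma tropical_locus_large_cell:
  fixes c :: "int ^ 'm::finite \<Rightarrow> real ^ 'n::{finite,linorder}"
  assumes U: "finite U" "card U \<ge> 2"
  obtains p where "p \<in> tropical_locus U c"
    "int CARD('m) * int CARD('n) - int CARD('n) \<le> aff_dim (closed_cell (comparison_hyperplanes U c) p)"
proof -
  obtain u0 u1 and D :: "int ^ 'm" where u: "u0 \<in> U" "u1 \<in> U" "u0 \<noteq> u1"
    and D1: "(\<Sum>j\<in>UNIV. (u1 - u0) $ j * D $ j) = 0"
    and D: "\<forall>w\<in>U. (\<Sum>j\<in>UNIV. (w - u0) $ j * D $ j) \<ge> 0"
    and edge: "\<forall>w\<in>U. w \<noteq> u0 \<longrightarrow> (\<Sum>j\<in>UNIV. (w - u0) $ j * D $ j) = 0 \<longrightarrow>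
       (\<exists>r>0. \<forall>j. real_of_int ((w - u0) $ j) = r * real_of_int ((u1 - u0) $ j))"
    by (rule exists_edge[OF U])
  define s where "s w = (\<Sum>j\<in>UNIV. (w - u0) $ j * D $ j)" for w
  \<comment> \<open>The exponents on the edge apart from \<open>u0\<close>. All exponents off the
    edge have \<open>s w \<ge> 1\<close>, by integrality.\<close>
  define E where "E = {w\<in>U. w \<noteq> u0 \<and> s w = 0}"
  define e :: "real ^ 'm" where "e = (\<chi> j. real_of_int ((u1 - u0) $ j))"
  obtain j where "u0 $ j \<noteq> u1 $ j" using u(3) by (auto simp: vec_eq_iff)
  then have "e $ j \<noteq> 0" by (simp add: e_def)
  then have e: "e \<noteq> 0" by force
  have E: "finite E" "u1 \<in> E" using U u D1 by (auto simp: E_def s_def)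
  have "\<exists>r>0. \<forall>j. real_of_int ((w - u0) $ j) = r * e $ j" if "w \<in> E" for w
    using edge that by (simp add: E_def s_def e_def)
  then have "\<exists>r. \<forall>w\<in>E. r w > 0 \<and> (\<forall>j. real_of_int ((w - u0) $ j) = r w * e $ j)"
    by (intro bchoice ballI)
  then obtain r where r: "\<And>w. w \<in> E \<Longrightarrow> r w > 0"
      "\<And>w j. w \<in> E \<Longrightarrow> real_of_int ((w - u0) $ j) = r w * e $ j"
    by blast
  \<comment> \<open>The value of the pairing with \<open>e\<close> at which the terms of
    \<open>w\<close> and \<open>u0\<close> agree.\<close>
  define g where "g w = (1 / r w) *\<^sub>R (c u0 - c w)" for w
  obtain w0 where w0: "w0 \<in> E" "\<And>w. w \<in> E \<Longrightarrow> lex_nonneg (g w0 - g w)"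
    using exists_lex_max[of E g] E by blast
  define q where "q = g w0"
  define A where "A = {p. (\<Sum>j\<in>UNIV. e $ j *\<^sub>R p $ j) = q}"
  define top where "top = (Max UNIV :: 'n)"
  define h where "h w p = (trop_term c w p - trop_term c u0 p) $ top" for w p
  \<comment> \<open>Positivity of the most significant coordinate alone is an open condition and
    still implies \<open>lex_nonneg\<close>.\<close>
  define W where "W = {p. \<forall>w\<in>U - E - {u0}. 0 < h w p}"
  have h: "h w p = (\<chi> j. axis top (real_of_int (w $ j - u0 $ j))) \<bullet> p - (c u0 - c w) $ top" for w p
    unfolding h_def by (rule trop_term_diff_component)
  have "W = (\<Inter>w\<in>U - E - {u0}. {p. 0 < h w p})" by (auto simp: W_def)
  moreover have "open {p. 0 < h w p}" for w
    unfolding h by (intro open_Collect_less continuous_intros)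
  ultimately have "open W" using U(1) by auto
  have on_edge: "trop_term c w p - trop_term c u0 p = r w *\<^sub>R (q - g w)" if "p \<in> A" "w \<in> E" for p w
  proof -
    have "(\<Sum>j\<in>UNIV. real_of_int (w $ j - u0 $ j) *\<^sub>R p $ j) = (\<Sum>j\<in>UNIV. r w *\<^sub>R (e $ j *\<^sub>R p $ j))"
      using r(2)[OF that(2)] by (intro sum.cong) auto
    also have "\<dots> = r w *\<^sub>R (\<Sum>j\<in>UNIV. e $ j *\<^sub>R p $ j)"
      by (simp only: scaleR_sum_right)
    also have "\<dots> = r w *\<^sub>R q" using that(1) by (simp add: A_def)
    finally show ?thesis
      unfolding trop_term_diff using r(1)[OF that(2)] by (simp add: g_def scaleR_diff_right)
  qed
  have AW: "A \<inter> W \<subseteq> tropical_locus U c"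
  proof
    fix p assume p: "p \<in> A \<inter> W"
    have "trop_term c u0 p = trop_term c w0 p"
      using on_edge[of p w0] p w0(1) by (simp add: q_def)
    moreover have "lex_nonneg (trop_term c w p - trop_term c u0 p)" if w: "w \<in> U" for w
    proof -
      consider "w = u0" | "w \<in> E" | "w \<in> U - E - {u0}" using w by blast
      then show ?thesis
      proof cases
        case 2
        then show ?thesis
          using on_edge[of p w] p w0(2) r(1) by (auto simp: q_def intro: lex_nonneg_scaleR)
      next
        case 3
        then have "h w p > 0" using p by (auto simp: W_def)
        then show ?thesis unfolding h_def top_def by (rule lex_nonneg_top)
      qed simp
    qed
    moreover have "w0 \<in> U" "u0 \<noteq> w0" using w0(1) by (auto simp: E_def)
    ultimately show "p \<in> tropical_locus U c"
      unfolding tropical_locus_def using u(1) by blast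
  qed
  have "A \<inter> W \<noteq> {}"
  proof -
    obtain p0 where p0: "(\<Sum>j\<in>UNIV. e $ j *\<^sub>R p0 $ j) = q"
      using combination_level_set_nonempty[OF e] by blast
    \<comment> \<open>\<open>D\<close> placed in the most significant column. It annihilates the
      edge direction, so adding multiples of \<open>z\<close> does not leave
      \<open>A\<close>.\<close>
    define z where "z = (\<chi> j. axis top (real_of_int (D $ j)))"
    \<comment> \<open>Exceeds every \<open>\<bar>h w p0\<bar>\<close>, while moving by
      \<open>t *\<^sub>R z\<close> raises \<open>h w\<close> by \<open>t\<close> times an integer
      that is at least one off the edge.\<close>
    define t where "t = 1 + (\<Sum>w\<in>U. \<bar>h w p0\<bar>)"
    have "(\<Sum>j\<in>UNIV. e $ j *\<^sub>R z $ j) = 0"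
    proof (rule vec_eq_iff[THEN iffD2], rule allI)
      fix i
      have "(\<Sum>j\<in>UNIV. e $ j *\<^sub>R z $ j) $ i = (if i = top then real_of_int (s u1) else 0)"
        by (simp add: z_def e_def s_def axis_def)
      then show "(\<Sum>j\<in>UNIV. e $ j *\<^sub>R z $ j) $ i = 0 $ i"
        using E(2) by (simp add: E_def)
    qed
    moreover have "(\<Sum>j\<in>UNIV. e $ j *\<^sub>R (p0 + t *\<^sub>R z) $ j) =
        (\<Sum>j\<in>UNIV. e $ j *\<^sub>R p0 $ j) + t *\<^sub>R (\<Sum>j\<in>UNIV. e $ j *\<^sub>R z $ j)"
      by (simp add: scaleR_add_right sum.distrib scaleR_sum_right mult.commute)
    ultimately have "p0 + t *\<^sub>R z \<in> A"
      using p0 by (simp add: A_def)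
    moreover have "h w (p0 + t *\<^sub>R z) > 0" if w: "w \<in> U - E - {u0}" for w
    proof -
      have hz: "h w (p0 + t *\<^sub>R z) = h w p0 + t * real_of_int (s w)"
        by (simp add: h inner_add_right inner_axis_matrix[of top _ z])
          (simp add: z_def s_def)
      have "s w \<ge> 0" "s w \<noteq> 0" using D w by (auto simp: E_def s_def)
      then have sw: "real_of_int (s w) \<ge> 1" by linarith
      have t: "\<bar>h w p0\<bar> < t"
        using member_le_sum[of w U "\<lambda>w. \<bar>h w p0\<bar>"] w U(1) by (simp add: t_def)
      then have "t * 1 \<le> t * real_of_int (s w)" using sw by (intro mult_left_mono) auto
      then show ?thesis unfolding hz using t by linarith
    qed
    ultimately show ?thesis by (auto simp: W_def)
  qed
  moreover have "affine A" unfolding A_def by (rule affine_combination_level_set)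
  ultimately obtain p where p: "p \<in> A \<inter> W" "aff_dim A \<le> aff_dim (closed_cell (comparison_hyperplanes U c) p)"
    using aff_dim_le_closed_cell[OF finite_comparison_hyperplanes[OF U(1)] _ \<open>open W\<close>] by metis
  have "aff_dim A = int CARD('m) * int CARD('n) - int CARD('n)"
    unfolding A_def by (rule aff_dim_combination_level_set[OF e])
  then show thesis using p AW by (intro that[of p]) auto
qed

lemma closure_rational_matrices: "closure {p :: real ^ 'n ^ 'm. \<forall>j i. p $ j $ i \<in> \<rat>} = UNIV"
proof -
  have "p \<in> closure {p. \<forall>j i. p $ j $ i \<in> \<rat>}" for p :: "real ^ 'n ^ 'm"
  proof -
    have "\<exists>s :: nat \<Rightarrow> real. (\<forall>k. s k \<in> \<rat>) \<and> s \<longlonglongrightarrow> x" for x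
      using closure_sequential[of x "\<rat> :: real set"] Rats_closure_real by auto
    then obtain s where s: "\<And>x k. s x k \<in> \<rat>" "\<And>x. s x \<longlonglongrightarrow> (x :: real)" by metis
    have "(\<lambda>k. \<chi> j i. s (p $ j $ i) k) \<longlonglongrightarrow> p"
      by (intro vec_tendstoI) (simp add: s(2))
    then show ?thesis
      unfolding closure_sequential by (intro exI[of _ "\<lambda>k. \<chi> j i. s (p $ j $ i) k"]) (simp add: s(1))
  qed
  then show ?thesis by blast
qed

lemma tropical_locus_complex:
  fixes c :: "int ^ 'm::finite \<Rightarrow> real ^ 'n::{finite,linorder}"
  assumes U: "finite U" "card U \<ge> 2" and c: "\<And>u i. u \<in> U \<Longrightarrow> c u $ i \<in> \<rat>"
  defines "V \<equiv> {p. \<forall>j i. p $ j $ i \<in> \<rat>}"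
  shows "\<exists>\<C>. rational_polyhedral_complex V \<C> \<and>
    complex_dimension \<C> (int CARD('m) * int CARD('n) - int CARD('n)) \<and>
    closure (tropical_locus U c \<inter> V) = \<Union>\<C>"
proof -
  let ?G = "comparison_hyperplanes U c" and ?T = "tropical_locus U c"
  have G: "finite ?G" by (rule finite_comparison_hyperplanes[OF U(1)])
  have rat: "a \<noteq> 0 \<and> (\<forall>v\<in>V. a \<bullet> v \<in> \<rat>) \<and> b \<in> \<rat>" if "(a, b) \<in> ?G" for a b
    using comparison_hyperplanes_rational[of U c, OF c that] unfolding V_def .
  obtain p where p: "p \<in> ?T"
    "int CARD('m) * int CARD('n) - int CARD('n) \<le> aff_dim (closed_cell ?G p)"
    using tropical_locus_large_cell[OF U] by blast
  obtain u v where "u \<in> U" "v \<in> U" "u \<noteq> v" using p(1) by (auto simp: tropical_locus_def)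
  then have "?G \<noteq> {}" by (auto simp: comparison_hyperplanes_def)
  then have "rational_polyhedral_complex V (cell_complex ?G ?T)"
    by (intro rational_polyhedral_complex_cell_complex G rat)
  moreover have "complex_dimension (cell_complex ?G ?T) (int CARD('m) * int CARD('n) - int CARD('n))"
    unfolding complex_dimension_def
  proof (intro conjI ballI)
    show "\<exists>S\<in>cell_complex ?G ?T. aff_dim S = int CARD('m) * int CARD('n) - int CARD('n)"
    proof
      show "closed_cell ?G p \<in> cell_complex ?G ?T"
        using p(1) by (auto simp: cell_complex_def intro: face_of_refl convex_closed_cell)
      show "aff_dim (closed_cell ?G p) = int CARD('m) * int CARD('n) - int CARD('n)"
        using p(2) aff_dim_closed_cell_tropical_locus[OF p(1)] by simp
    qed
    fix F assume "F \<in> cell_complex ?G ?T"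
    then obtain x where x: "x \<in> ?T" "F \<subseteq> closed_cell ?G x"
      using face_of_imp_subset by (auto simp: cell_complex_def)
    then show "aff_dim F \<le> int CARD('m) * int CARD('n) - int CARD('n)"
      using aff_dim_closed_cell_tropical_locus[OF x(1)] aff_dim_subset[OF x(2)] by linarith
  qed
  moreover have "closure (?T \<inter> V) = \<Union>(cell_complex ?G ?T)"
  proof (rule closure_rational_points_eq_Union_cell_complex)
    show "closure V = UNIV" unfolding V_def by (rule closure_rational_matrices)
    show "u - v \<in> V" if "u \<in> V" "v \<in> V" for u v using that by (simp add: V_def)
    show "q *\<^sub>R v \<in> V" if "q \<in> \<rat>" "v \<in> V" for q v using that by (simp add: V_def)
    show "open_cell ?G x \<subseteq> ?T" if "x \<in> ?T" for x
      using that by (rule open_cell_subset_tropical_locus)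
  qed (use G rat in auto)
  ultimately show ?thesis by blast
qed

section \<open>Valuations of the points of a hypersurface\<close>

lemma rank_n_ring_closure_one_add:
  assumes "n \<ge> 1" "x \<in> rank_n_ring_closure n T"
  shows "1 + x \<in> rank_n_ring_closure n T"
proof -
  obtain L S \<iota> where S: "subfield L ring_of_type_algebra" "higher_local_field n S"
      "level S n = ring_of_type_algebra\<lparr>carrier := L\<rparr>" "finite_tower_extension n T S \<iota>" "\<iota> n = to_ac"
      "x \<in> rank_n_ring n S"
    using assms(2) unfolding rank_n_ring_closure_def by blast
  have "1 + x \<in> rank_n_ring n S"
    using rank_n_ring_one_add(2)[OF S(2) assms(1) S(6)] by (simp add: S(3) ring_of_type_algebra_def)
  then show ?thesis using S unfolding rank_n_ring_closure_def by blast
qed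

text \<open>Factor out the summand of smaller value: \<open>x + y = x * (1 + y / x)\<close>, where
  \<open>y / x\<close> lies in the valuation ring and hence so does
  \<open>1 + y / x\<close>.\<close>

lemma krull_valuation_rank_n_valuation:
  assumes "n \<ge> 1" and \<nu>: "rank_n_valuation n T \<nu>"
  shows "krull_valuation (\<lambda>x. lex_of_vec (\<nu> x))"
proof
  have mult: "\<nu> (x * y) = \<nu> x + \<nu> y" if "x \<noteq> 0" "y \<noteq> 0" for x y
    using \<nu> that by (simp add: rank_n_valuation_def)
  have nonneg: "lex_nonneg (\<nu> x) \<longleftrightarrow> x \<in> rank_n_ring_closure n T" if "x \<noteq> 0" for x
    using \<nu> that by (simp add: rank_n_valuation_def)
  show "lex_of_vec (\<nu> (x * y)) = lex_of_vec (\<nu> x) + lex_of_vec (\<nu> y)" if "x \<noteq> 0" "y \<noteq> 0" for x y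
    by (simp add: mult that lex_of_vec_simps)
  have *: "lex_of_vec (\<nu> x) \<le> lex_of_vec (\<nu> (x + y))"
    if xy: "x \<noteq> 0" "y \<noteq> 0" "x + y \<noteq> 0" "lex_of_vec (\<nu> x) \<le> lex_of_vec (\<nu> y)" for x y
  proof -
    define z where "z = y / x"
    have z: "z \<noteq> 0" "y = x * z" "x + y = x * (1 + z)" "1 + z \<noteq> 0"
      using xy by (auto simp: z_def field_simps)
    have "lex_nonneg (\<nu> z)" using xy(4) unfolding lex_of_vec_simps(2) z(2) mult[OF xy(1) z(1)] by simp
    then have "lex_nonneg (\<nu> (1 + z))"
      using rank_n_ring_closure_one_add[OF assms(1)] nonneg z(1,4) by blast
    then show ?thesis unfolding lex_of_vec_simps(2) z(3) mult[OF xy(1) z(4)] by simp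
  qed
  show "min (lex_of_vec (\<nu> x)) (lex_of_vec (\<nu> y)) \<le> lex_of_vec (\<nu> (x + y))"
    if "x \<noteq> 0" "y \<noteq> 0" "x + y \<noteq> 0" for x y
    using *[of x y] *[of y x] that by (auto simp: min_def add.commute)
qed

section \<open>The value group of the algebraic closure\<close>

lemma additive_valuation_power:
  fixes \<nu> :: "'a::field \<Rightarrow> 'b::real_vector"
  assumes mult: "\<And>x y. x \<noteq> 0 \<Longrightarrow> y \<noteq> 0 \<Longrightarrow> \<nu> (x * y) = \<nu> x + \<nu> y"
  shows "x \<noteq> 0 \<Longrightarrow> \<nu> (x ^ k) = real k *\<^sub>R \<nu> x"
    and "x \<noteq> 0 \<Longrightarrow> \<nu> (x powi e) = real_of_int e *\<^sub>R \<nu> x"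
    and "(\<And>j. j \<in> J \<Longrightarrow> g j \<noteq> 0) \<Longrightarrow> \<nu> (prod g J) = (\<Sum>j\<in>J. \<nu> (g j))"
proof -
  have one: "\<nu> 1 = 0" using mult[of 1 1] by simp
  have pow: "\<nu> (x ^ k) = real k *\<^sub>R \<nu> x" if "x \<noteq> 0" for x k
    by (induction k) (simp_all add: one mult that scaleR_add_left)
  then show "x \<noteq> 0 \<Longrightarrow> \<nu> (x ^ k) = real k *\<^sub>R \<nu> x" .
  show "\<nu> (x powi e) = real_of_int e *\<^sub>R \<nu> x" if x: "x \<noteq> 0"
  proof (cases "e \<ge> 0")
    case True
    then show ?thesis using x by (simp add: power_int_def pow)
  next
    case False
    have "\<nu> (inverse x) + \<nu> x = 0" using mult[of "inverse x" x] x one by simp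
    then have "\<nu> (inverse x) = - \<nu> x" by (simp add: eq_neg_iff_add_eq_0)
    then show ?thesis using False x by (simp add: power_int_def pow)
  qed
  show "(\<And>j. j \<in> J \<Longrightarrow> g j \<noteq> 0) \<Longrightarrow> \<nu> (prod g J) = (\<Sum>j\<in>J. \<nu> (g j))"
    by (induction J rule: infinite_finite_induct) (simp_all add: one mult)
qed

lemma power_int_sum:
  fixes x :: "'a::field"
  assumes "x \<noteq> 0"
  shows "x powi (\<Sum>j\<in>J. g j) = (\<Prod>j\<in>J. x powi g j)"
  using assms by (induction J rule: infinite_finite_induct) (simp_all add: power_int_add)

lemma common_denominator:
  assumes "finite A" "A \<subseteq> \<rat>"
  shows "\<exists>k>0. \<forall>a\<in>A. real k * a \<in> \<int>"
  using assms
proof (induction A)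
  case (insert a A)
  then obtain k where k: "k > 0" "\<forall>a\<in>A. real k * a \<in> \<int>" by auto
  obtain p q :: int where pq: "q > 0" "a = of_int p / of_int q"
    using insert.prems by (auto elim: Rats_cases')
  have "real (nat q * k) * x \<in> \<int>" if x: "x \<in> insert a A" for x
  proof (cases "x = a")
    case True
    have "real (nat q * k) * x = of_int (int k * p)" using pq True by simp
    then show ?thesis by (metis Ints_of_int)
  next
    case False
    have "real (nat q * k) * x = of_int q * (real k * x)" using pq(1) by simp
    then show ?thesis using k(2) x False by (metis Ints_mult Ints_of_int insertE)
  qed
  moreover have "nat q * k > 0" using pq(1) k(1) by simp
  ultimately show ?case by blast
qed auto

text \<open>An algebraic equation for \<open>x\<close> over the base field cannot have a single term
  of least value. Two terms tie, and dividing by the difference of their exponents expresses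
  \<open>\<nu> x\<close> through values of coefficients. Conversely, roots in the algebraic closure
  realize every rational vector.\<close>

lemma value_group_rank_n_valuation:
  fixes \<nu> :: "'k::field alg_closure \<Rightarrow> real ^ 'n::{finite,linorder}"
  assumes "n \<ge> 1" and \<nu>: "rank_n_valuation n T \<nu>"
  shows "value_group \<nu> = {z. \<forall>i. z $ i \<in> \<rat>}"
proof (rule subset_antisym)
  have mult: "\<nu> (x * y) = \<nu> x + \<nu> y" if "x \<noteq> 0" "y \<noteq> 0" for x y
    using \<nu> that by (simp add: rank_n_valuation_def)
  have power: "\<nu> (x ^ k) = real k *\<^sub>R \<nu> x" if "x \<noteq> 0" for x k
    using mult that by (rule additive_valuation_power(1))
  have image: "(\<lambda>x. \<nu> (to_ac x)) ` (UNIV - {0}) = {z. \<forall>i. z $ i \<in> \<int>}"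
    using \<nu> by (simp add: rank_n_valuation_def)
  interpret krull_valuation "\<lambda>x. lex_of_vec (\<nu> x)" by (rule krull_valuation_rank_n_valuation[OF assms])
  show "value_group \<nu> \<subseteq> {z. \<forall>i. z $ i \<in> \<rat>}"
    unfolding value_group_def
  proof clarify
    fix x :: "'k alg_closure" and i assume x: "x \<noteq> 0"
    obtain p :: "'k Polynomial.poly" where p: "p \<noteq> 0" "Polynomial.poly (map_poly to_ac p) x = 0"
      by (rule alg_closure_algebraic)
    define g where "g i = to_ac (poly.coeff p i) * x ^ i" for i
    define U where "U = {i. i \<le> Polynomial.degree p \<and> poly.coeff p i \<noteq> 0}"
    have U: "finite U" "U \<noteq> {}" using p(1) by (auto simp: U_def)
    have g: "g i \<noteq> 0" if "i \<in> U" for i using that x by (simp add: g_def U_def)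
    have "sum g U = (\<Sum>i\<le>Polynomial.degree p. g i)"
      by (rule sum.mono_neutral_left) (auto simp: U_def g_def)
    also have "\<dots> = Polynomial.poly (map_poly to_ac p) x"
      by (simp add: poly_altdef g_def coeff_map_poly degree_map_poly)
    finally have "\<not> unique_min g U" using sum_unique_min_nonzero[OF U(1), of g] p(2) by auto
    then obtain a b where ab: "a \<in> U" "b \<in> U" "a \<noteq> b" "\<nu> (g a) = \<nu> (g b)"
      using not_unique_min_iff[of U g, OF U g] by (auto simp: lex_of_vec_simps(3))
    have int: "\<nu> (to_ac (poly.coeff p k)) $ i \<in> \<rat>" if "k \<in> U" for k
    proof -
      have "\<nu> (to_ac (poly.coeff p k)) \<in> (\<lambda>x. \<nu> (to_ac x)) ` (UNIV - {0})"
        using that by (auto simp: U_def)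
      then show ?thesis unfolding image using Ints_subset_Rats by blast
    qed
    have \<nu>_g: "\<nu> (g k) $ i = \<nu> (to_ac (poly.coeff p k)) $ i + real k * \<nu> x $ i" if "k \<in> U" for k
      using that x by (simp add: g_def U_def mult power)
    have "(real a - real b) * \<nu> x $ i = \<nu> (to_ac (poly.coeff p b)) $ i - \<nu> (to_ac (poly.coeff p a)) $ i"
      using \<nu>_g[OF ab(1)] \<nu>_g[OF ab(2)] ab(4) by (simp add: algebra_simps)
    then have "\<nu> x $ i = (\<nu> (to_ac (poly.coeff p b)) $ i - \<nu> (to_ac (poly.coeff p a)) $ i) / (real a - real b)"
      using ab(3) by (simp add: field_simps)
    then show "\<nu> x $ i \<in> \<rat>" using int ab(1,2) by (simp add: Rats_divide Rats_diff)
  qed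
  show "{z. \<forall>i. z $ i \<in> \<rat>} \<subseteq> value_group \<nu>"
  proof
    fix z :: "(real, 'n) vec" assume "z \<in> {z. \<forall>i. z $ i \<in> \<rat>}"
    then obtain k :: nat where k: "k > 0" "\<And>i. real k * z $ i \<in> \<int>"
      using common_denominator[of "range (\<lambda>i. z $ i)"] by auto
    have "real k *\<^sub>R z \<in> (\<lambda>x. \<nu> (to_ac x)) ` (UNIV - {0})" unfolding image using k(2) by simp
    then obtain a where "real k *\<^sub>R z = \<nu> (to_ac a)" "a \<in> UNIV - {0}" by (rule imageE)
    then have a: "a \<noteq> 0" "\<nu> (to_ac a) = real k *\<^sub>R z" by simp_all
    obtain y where y: "y ^ k = to_ac a" using nth_root_exists[OF k(1)] by blast
    have "y \<noteq> 0" using y a(1) k(1) by (metis power_0_left to_ac_eq_0_iff not_gr_zero)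
    moreover have "\<nu> y = z" using power[OF \<open>y \<noteq> 0\<close>, of k] a(2) k(1) by (simp add: y)
    ultimately show "z \<in> value_group \<nu>" unfolding value_group_def by blast
  qed
qed

text \<open>Kapranov's theorem.  A preimage of a point of the tropical locus is sought on a monomial curve
  with parameter \<open>s\<close>, whose integral direction \<open>d\<close> separates the exponents of \<open>f\<close>, so that no monomials
  merge and one obtains a Laurent polynomial in \<open>s\<close> with two coefficients of minimal valuation.\<close>

lemma hypersurface_valuations:
  fixes \<nu> :: "'k::field alg_closure \<Rightarrow> real ^ 'n::{finite,linorder}"
    and f :: "(int ^ 'm::finite) \<Rightarrow>\<^sub>0 'k"
  assumes "krull_valuation (\<lambda>x. lex_of_vec (\<nu> x))" and "f \<noteq> 0"
  defines "U \<equiv> Poly_Mapping.keys f" and "c \<equiv> \<lambda>u. \<nu> (to_ac (Poly_Mapping.lookup f u))"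
  shows "(\<lambda>t. \<chi> j. \<nu> (t $ j)) ` hypersurface_points f =
    tropical_locus U c \<inter> {p. \<forall>j. p $ j \<in> value_group \<nu>}"
proof (rule subset_antisym)
  interpret krull_valuation "\<lambda>x. lex_of_vec (\<nu> x)" by fact
  have mult: "\<nu> (x * y) = \<nu> x + \<nu> y" if "x \<noteq> 0" "y \<noteq> 0" for x y
    using v_mult[OF that] by (simp flip: lex_of_vec_simps(1) add: lex_of_vec_simps(3))
  have power: "\<nu> (x powi e) = real_of_int e *\<^sub>R \<nu> x" if "x \<noteq> 0" for x e
    using mult that by (rule additive_valuation_power(2))
  have U: "finite U" "U \<noteq> {}" using assms(2) by (simp_all add: U_def)
  define g where "g t u = to_ac (Poly_Mapping.lookup f u) * (\<Prod>j\<in>UNIV. (t $ j) powi (u $ j))"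
    for t :: "'k alg_closure ^ 'm" and u
  have coeff: "Poly_Mapping.lookup f u \<noteq> 0" if "u \<in> U" for u
    using that by (simp add: U_def in_keys_iff)
  have g_nz: "g t u \<noteq> 0" if "u \<in> U" "\<And>j. t $ j \<noteq> 0" for t u
    using that coeff by (simp add: g_def power_int_eq_0_iff)
  have \<nu>_g: "\<nu> (g t u) = trop_term c u (\<chi> j. \<nu> (t $ j))" if "u \<in> U" "\<And>j. t $ j \<noteq> 0" for t u
  proof -
    have "\<nu> (g t u) = c u + \<nu> (\<Prod>j\<in>UNIV. (t $ j) powi (u $ j))"
      unfolding g_def c_def using that coeff by (intro mult) (simp_all add: power_int_eq_0_iff)
    also have "\<nu> (\<Prod>j\<in>UNIV. (t $ j) powi (u $ j)) = (\<Sum>j\<in>UNIV. \<nu> ((t $ j) powi (u $ j)))"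
      using mult by (rule additive_valuation_power(3)) (use that in simp_all)
    also have "\<dots> = (\<Sum>j\<in>UNIV. real_of_int (u $ j) *\<^sub>R \<nu> (t $ j))"
      using that by (intro sum.cong refl power)
    finally show ?thesis by (simp add: trop_term_def)
  qed
  have locus: "\<not> unique_min (g t) U \<longleftrightarrow> (\<chi> j. \<nu> (t $ j)) \<in> tropical_locus U c" if "\<And>j. t $ j \<noteq> 0" for t
  proof -
    have "\<not> unique_min (g t) U \<longleftrightarrow> (\<exists>u\<in>U. \<exists>w\<in>U. u \<noteq> w \<and> lex_of_vec (\<nu> (g t u)) = lex_of_vec (\<nu> (g t w)) \<and>
        (\<forall>x\<in>U. lex_of_vec (\<nu> (g t u)) \<le> lex_of_vec (\<nu> (g t x))))"
      by (rule not_unique_min_iff[OF U]) (rule g_nz[OF _ that])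
    then show ?thesis
      unfolding tropical_locus_def mem_Collect_eq lex_of_vec_simps by (simp add: \<nu>_g that cong: bex_cong_simp ball_cong_simp)
  qed
  have eval: "eval_laurent f t = sum (g t) U" for t
    by (simp add: eval_laurent_def g_def U_def)
  show "(\<lambda>t. \<chi> j. \<nu> (t $ j)) ` hypersurface_points f \<subseteq>
    tropical_locus U c \<inter> {p. \<forall>j. p $ j \<in> value_group \<nu>}"
  proof clarify
    fix t assume "t \<in> hypersurface_points f"
    then have t: "\<And>j. t $ j \<noteq> 0" "sum (g t) U = 0" by (auto simp: hypersurface_points_def eval)
    have "(\<chi> j. \<nu> (t $ j)) \<in> tropical_locus U c"
      using locus[of t, OF t(1)] sum_unique_min_nonzero[OF U(1), of "g t"] t(2) by blast
    then show "(\<chi> j. \<nu> (t $ j)) \<in> tropical_locus U c \<inter> {p. \<forall>j. p $ j \<in> value_group \<nu>}"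
      using t(1) by (auto simp: value_group_def)
  qed
  show "tropical_locus U c \<inter> {p. \<forall>j. p $ j \<in> value_group \<nu>} \<subseteq>
    (\<lambda>t. \<chi> j. \<nu> (t $ j)) ` hypersurface_points f"
  proof
    fix p assume p: "p \<in> tropical_locus U c \<inter> {p. \<forall>j. p $ j \<in> value_group \<nu>}"
    have "\<exists>x. x \<noteq> 0 \<and> \<nu> x = p $ j" for j
    proof -
      have "p $ j \<in> \<nu> ` (UNIV - {0})" using p by (simp add: value_group_def)
      then show ?thesis by auto
    qed
    then obtain \<tau> where \<tau>: "\<And>j. \<tau> j \<noteq> 0" "\<And>j. \<nu> (\<tau> j) = p $ j" by metis
    \<comment> \<open>A point with the prescribed valuations, in general off the hypersurface; the
      parameter \<open>s\<close> found below moves it there.\<close>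
    define t0 where "t0 = (\<chi> j. \<tau> j)"
    have t0: "\<And>j. t0 $ j \<noteq> 0" "(\<chi> j. \<nu> (t0 $ j)) = p" using \<tau> by (auto simp: t0_def vec_eq_iff)
    have "\<exists>d :: int ^ 'm. \<forall>x\<in>(\<lambda>(u, w). u - w) ` (U \<times> U) - {0}. (\<Sum>j\<in>UNIV. x $ j * d $ j) \<noteq> 0"
      using U(1) by (intro exists_integer_functional_nonzero) auto
    then obtain d :: "int ^ 'm" where
      "\<forall>x\<in>(\<lambda>(u, w). u - w) ` (U \<times> U) - {0}. (\<Sum>j\<in>UNIV. x $ j * d $ j) \<noteq> 0"
      by (rule exE)
    note d = bspec[OF this]
    define e where "e u = (\<Sum>j\<in>UNIV. u $ j * d $ j)" for u
    have "inj_on e U"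
    proof (rule inj_onI, rule ccontr)
      fix u w assume uw: "u \<in> U" "w \<in> U" "e u = e w" "u \<noteq> w"
      have "(\<Sum>j\<in>UNIV. (u - w) $ j * d $ j) = e u - e w"
        by (simp add: e_def left_diff_distrib sum_subtractf)
      moreover have "u - w \<in> (\<lambda>(u, w). u - w) ` (U \<times> U) - {0}" using uw(1,2,4) by auto
      ultimately show False using d[of "u - w"] uw(3) by simp
    qed
    moreover have "\<not> unique_min (g t0) U" using locus[of t0, OF t0(1)] t0(2) p by simp
    ultimately have "\<exists>s. s \<noteq> 0 \<and> lex_of_vec (\<nu> s) = 0 \<and> (\<Sum>u\<in>U. g t0 u * s powi e u) = 0"
      using g_nz[OF _ t0(1)] by (intro laurent_root_of_valuation_zero[OF assms(1) U])
    then obtain s where s: "s \<noteq> 0" "lex_of_vec (\<nu> s) = 0" "(\<Sum>u\<in>U. g t0 u * s powi e u) = 0"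
      by (elim exE conjE)
    \<comment> \<open>Moving along the one-parameter subgroup of direction \<open>d\<close>
      multiplies the term of \<open>u\<close> by \<open>s powi e u\<close>. Valuations stay put
      because \<open>s\<close> has valuation zero.\<close>
    define t where "t = (\<chi> j. t0 $ j * s powi (d $ j))"
    have t: "t $ j \<noteq> 0" for j using s(1) t0(1) by (simp add: t_def power_int_eq_0_iff)
    have "g t u = g t0 u * s powi e u" for u
    proof -
      have "(\<Prod>j\<in>UNIV. (t $ j) powi (u $ j)) =
          (\<Prod>j\<in>UNIV. (t0 $ j) powi (u $ j)) * (\<Prod>j\<in>UNIV. s powi (u $ j * d $ j))"
        by (simp add: t_def power_int_mult_distrib prod.distrib mult.commute flip: power_int_mult)
      also have "(\<Prod>j\<in>UNIV. s powi (u $ j * d $ j)) = s powi e u"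
        unfolding e_def by (rule power_int_sum[OF s(1), symmetric])
      finally show ?thesis by (simp add: g_def)
    qed
    then have "t \<in> hypersurface_points f" using t s(3) by (simp add: hypersurface_points_def eval)
    moreover have "\<nu> (t $ j) = p $ j" for j
    proof -
      have "\<nu> (t $ j) = \<nu> (t0 $ j) + real_of_int (d $ j) *\<^sub>R \<nu> s"
        using s(1) t0(1) by (simp add: t_def mult power)
      then show ?thesis using s(2) \<tau>(2) by (simp add: lex_of_vec_simps t0_def)
    qed
    then have "(\<chi> j. \<nu> (t $ j)) = p" by (simp add: vec_eq_iff)
    ultimately show "p \<in> (\<lambda>t. \<chi> j. \<nu> (t $ j)) ` hypersurface_points f" by blast
  qed
qed

text \<open>A nonzero Laurent polynomial with a single term is a unit, so no prime ideal contains
  it, whereas an irreducible space is nonempty. Two exponents are what the choice of an edge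
  requires.\<close>

lemma card_keys_hypersurface:
  fixes f :: "(int ^ 'm::finite) \<Rightarrow>\<^sub>0 'k::field"
  assumes "reduced_irreducible_hypersurface f"
  shows "card (Poly_Mapping.keys f) \<ge> 2"
proof (rule ccontr)
  assume "\<not> ?thesis"
  moreover have "card (Poly_Mapping.keys f) \<noteq> 0"
    using assms by (simp add: reduced_irreducible_hypersurface_def)
  ultimately have "card (Poly_Mapping.keys f) = 1" by linarith
  then obtain u where u: "Poly_Mapping.keys f = {u}" by (auto simp: card_1_singleton_iff)
  define a where "a = Poly_Mapping.lookup f u"
  have a: "a \<noteq> 0" using u by (simp add: a_def flip: in_keys_iff)
  have f: "f = Poly_Mapping.single u a"
  proof (rule poly_mapping_eqI)
    fix w
    show "Poly_Mapping.lookup f w = Poly_Mapping.lookup (Poly_Mapping.single u a) w"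
      using u by (cases "w = u") (auto simp: a_def lookup_single_not_eq not_in_keys_iff_lookup_eq_zero[symmetric])
  qed
  have inv: "f * Poly_Mapping.single (- u) (inverse a) = 1"
    using a by (simp add: f mult_single)
  obtain P where P: "primeideal P (ring_of_type_algebra :: ((int ^ 'm) \<Rightarrow>\<^sub>0 'k) ring)" "f \<in> P"
    using assms by (auto simp: reduced_irreducible_hypersurface_def zariski_irreducible_def zariski_closed_def)
  interpret P: primeideal P "ring_of_type_algebra :: ((int ^ 'm) \<Rightarrow>\<^sub>0 'k) ring" by fact
  have "f * Poly_Mapping.single (- u) (inverse a) \<in> P"
    using P.I_r_closed[OF P(2), of "Poly_Mapping.single (- u) (inverse a)"]
    by (simp add: ring_of_type_algebra_def)
  then have "\<one>\<^bsub>ring_of_type_algebra\<^esub> \<in> P" by (simp add: inv ring_of_type_algebra_def)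
  then show False using P.one_imp_carrier P.I_notcarr by blast
qed

theorem corollary5p1p3:
  fixes n :: nat
    and T :: "'k::field local_tower"
    and \<nu> :: "'k alg_closure \<Rightarrow> real ^ 'n::{finite,linorder}"
    and f :: "(int ^ 'm::finite) \<Rightarrow>\<^sub>0 'k"
  assumes "n \<ge> 1" and "CARD('n) = n"
    and "higher_local_field n T" and "level T n = ring_of_type_algebra"
    and "rank_n_valuation n T \<nu>"
    and "reduced_irreducible_hypersurface f"
  shows "\<exists>\<C>. rational_polyhedral_complex {p. \<forall>j. p $ j \<in> value_group \<nu>} \<C> \<and>
           complex_dimension \<C> (int CARD('m) * int n - int n) \<and>
           tropicalization \<nu> (hypersurface_points f) = \<Union> \<C>"
proof -
  define c where "c u = \<nu> (to_ac (Poly_Mapping.lookup f u))" for u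
  have V: "{p. \<forall>j. p $ j \<in> value_group \<nu>} = {p. \<forall>j i. p $ j $ i \<in> \<rat>}"
    unfolding value_group_rank_n_valuation[OF assms(1,5)] by simp
  have "f \<noteq> 0" using assms(6) by (simp add: reduced_irreducible_hypersurface_def)
  have trop: "tropicalization \<nu> (hypersurface_points f) =
      closure (tropical_locus (Poly_Mapping.keys f) c \<inter> {p. \<forall>j i. p $ j $ i \<in> \<rat>})"
    unfolding tropicalization_def c_def
    by (simp only: hypersurface_valuations[OF krull_valuation_rank_n_valuation[OF assms(1,5)] \<open>f \<noteq> 0\<close>] V)
  have "c u $ i \<in> \<rat>" if "u \<in> Poly_Mapping.keys f" for u i
  proof -
    have "c u \<in> value_group \<nu>"
      using that unfolding value_group_def c_def by (auto simp: in_keys_iff)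
    then show ?thesis unfolding value_group_rank_n_valuation[OF assms(1,5)] by simp
  qed
  from tropical_locus_complex[OF finite_keys card_keys_hypersurface[OF assms(6)] this]
  show ?thesis unfolding trop V assms(2) .
qed

end
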